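(* Let $\mathcal{F}=\{T_n\mid n\in\mathbb{N}\}$, with $T_n$ a spanning tree of the $n\times n$ grid graph $G(n)$, be a bounded, convergent, neighbor-independent family, and let $f$ be its associated power series. Then $$Q^-(\mathcal{F})\;\geq\;\frac{1}{e\cdot\overline{f}},\qquad\text{where } \overline{f}=\exp\left(\int_0^1\ln f(x)\,dx\right)$$ is the geometric mean of $f$.
   Context: $G(n)$ is the $n\times n$ square grid graph ($n^2$ vertices $\{1,\dots,n\}^2$, adjacent iff at Euclidean distance $1$). For a finite connected graph $G$ and spanning tree $T$, $\mathrm{Prob}_{\mathrm{MST}}(T)$ is the probability that $T$ is the output of the following algorithm: order the edges of $G$ uniformly at random and go through them in that order, adding each edge unless it would create a cycle with the edges already added. For a family $\mathcal{F}=\{T_n\}$, $Q^-(\mathcal{F})$ is defined by $\ln Q^-(\mathcal{F})=\liminf_{n\to\infty}\frac{\ln \mathrm{Prob}_{\mathrm{MST}}(T_n)}{n^2}$. Bipartite graph of a spanning tree $T$ of $G=(V,E)$: $\mathcal{G}=(\mathcal{V}_1,\mathcal{V}_2,\mathcal{E})$, where $\mathcal{V}_1=T$ (the tree edges, "branches"), $\mathcal{V}_2=E\setminus T$ (the "chords"), and a branch $b$ is adjacent to a chord $e$ iff $b$ lies on the unique cycle of $T\cup\{e\}$. The family is bounded if the average degree of the nodes in the bipartite graph of $T_n$, divided by $n^2$, tends to $0$ as $n\to\infty$. The degree-mass function of $T$ is $p:\mathbb{N}\to[0,1]$, where $p(d)$ is the proportion of nodes in $\mathcal{V}_2$ that have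 degree $d$ in $\mathcal{G}$ (for grids, $p(d)=0$ unless $d\ge 3$ is odd). Let $p_n$ be the degree-mass function of $T_n$ (for $n\ge 2$). The family is convergent if $p_\infty(d)=\lim_{n\to\infty}p_n(d)$ exists for every $d$; its associated power series is then the function $f:[0,1]\to\mathbb{R}$, $$f(x)=1+x-\sum_{d\geq 3}p_\infty(d)(1-x)^d.$$ The family is neighbor-independent if $\lim_{n\to\infty}|\tilde\Delta_n|/|\Delta_n|=0$, where $\Delta_n=\mathcal{V}_2\times\mathcal{V}_2$ (for $T_n$) and $\tilde\Delta_n$ is the set of pairs $(v,w)\in\Delta_n$ having at least one common neighbor in $\mathcal{V}_1$. *)

theory Defs
  imports "HOL-Probability.Probability" "HOL-Combinatorics.Multiset_Permutations"
begin

text \<open>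
  A simple undirected graph is given by a vertex set \<open>V\<close> and a set \<open>E\<close> of two-element subsets
  of \<open>V\<close>. Cycles are represented by their edge sets, so that ``the unique cycle'' below does not
  depend on a starting vertex or an orientation.
\<close>

definition is_cycle :: "'a set set \<Rightarrow> bool" where
  "is_cycle C \<longleftrightarrow> (\<exists>vs. length vs \<ge> 3 \<and> distinct vs \<and>
     C = {{vs ! i, vs ! (Suc i mod length vs)} | i. i < length vs})"

definition acyclic_edges :: "'a set set \<Rightarrow> bool" where
  "acyclic_edges F \<longleftrightarrow> \<not> (\<exists>C \<subseteq> F. is_cycle C)"

definition connected_graph :: "'a set \<Rightarrow> 'a set set \<Rightarrow> bool" where
  "connected_graph V E \<longleftrightarrow> V \<noteq> {} \<and> (\<forall>u\<in>V. \<forall>v\<in>V. (u, v) \<in> {(x, y). {x, y} \<in> E}\<^sup>*)"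

definition spanning_tree :: "'a set \<Rightarrow> 'a set set \<Rightarrow> 'a set set \<Rightarrow> bool" where
  "spanning_tree V E T \<longleftrightarrow> T \<subseteq> E \<and> connected_graph V T \<and> acyclic_edges T"

definition grid_vertices :: "nat \<Rightarrow> (nat \<times> nat) set" where
  "grid_vertices n = {1..n} \<times> {1..n}"

text \<open>The distance on \<^typ>\<open>real \<times> real\<close> is the Euclidean one.\<close>

definition grid_edges :: "nat \<Rightarrow> (nat \<times> nat) set set" where
  "grid_edges n = {{(a, b), (c, d)} | a b c d.
     (a, b) \<in> grid_vertices n \<and> (c, d) \<in> grid_vertices n \<and>
     dist (real a, real b) (real c, real d) = 1}"

definition kruskal_step :: "'a set set \<Rightarrow> 'a set \<Rightarrow> 'a set set" where
  "kruskal_step F e = (if acyclic_edges (insert e F) then insert e F else F)"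

definition kruskal :: "'a set list \<Rightarrow> 'a set set" where
  "kruskal es = foldl kruskal_step {} es"

definition prob_MST :: "'a set set \<Rightarrow> 'a set set \<Rightarrow> real" where
  "prob_MST E T = pmf (map_pmf kruskal (pmf_of_set (permutations_of_set E))) T"

text \<open>
  The limit inferior may a priori be \<open>-\<infinity>\<close>, in which case \<open>Q\<^sup>-\<close> is \<open>0\<close>; hence the extended reals.
\<close>

definition exp_ereal :: "ereal \<Rightarrow> ereal" where
  "exp_ereal x = (case x of ereal r \<Rightarrow> ereal (exp r) | PInfty \<Rightarrow> \<infinity> | MInfty \<Rightarrow> 0)"

definition Q_minus :: "(nat \<Rightarrow> (nat \<times> nat) set set) \<Rightarrow> ereal" where
  "Q_minus T = exp_ereal (liminf (\<lambda>n. ereal (ln (prob_MST (grid_edges n) (T n)) / (real n)\<^sup>2)))"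

definition fundamental_cycle :: "'a set set \<Rightarrow> 'a set \<Rightarrow> 'a set set" where
  "fundamental_cycle T e = (THE C. is_cycle C \<and> C \<subseteq> insert e T)"

text \<open>Both sides of the bipartite graph consist of edges of \<open>G\<close>: its node set is
  \<open>T \<union> (E - T)\<close>, and its edges are pairs (branch, chord).\<close>

definition bip_edges :: "'a set set \<Rightarrow> 'a set set \<Rightarrow> ('a set \<times> 'a set) set" where
  "bip_edges E T = {(b, e) \<in> T \<times> (E - T). b \<in> fundamental_cycle T e}"

definition bip_degree :: "'a set set \<Rightarrow> 'a set set \<Rightarrow> 'a set \<Rightarrow> nat" where
  "bip_degree E T v = card {w. (v, w) \<in> bip_edges E T \<or> (w, v) \<in> bip_edges E T}"

definition avg_degree :: "'a set set \<Rightarrow> 'a set set \<Rightarrow> real" where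
  "avg_degree E T = (\<Sum>v\<in>T \<union> (E - T). real (bip_degree E T v)) / real (card (T \<union> (E - T)))"

definition degree_mass :: "'a set set \<Rightarrow> 'a set set \<Rightarrow> nat \<Rightarrow> real" where
  "degree_mass E T d = real (card {e \<in> E - T. bip_degree E T e = d}) / real (card (E - T))"

definition chord_pairs :: "'a set set \<Rightarrow> 'a set set \<Rightarrow> ('a set \<times> 'a set) set" where
  "chord_pairs E T = (E - T) \<times> (E - T)"

definition neighboring_chord_pairs :: "'a set set \<Rightarrow> 'a set set \<Rightarrow> ('a set \<times> 'a set) set" where
  "neighboring_chord_pairs E T =
     {(v, w) \<in> chord_pairs E T. \<exists>b\<in>T. (b, v) \<in> bip_edges E T \<and> (b, w) \<in> bip_edges E T}"

definition bounded_family :: "(nat \<Rightarrow> (nat \<times> nat) set set) \<Rightarrow> bool" where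
  "bounded_family T \<longleftrightarrow> (\<lambda>n. avg_degree (grid_edges n) (T n) / (real n)\<^sup>2) \<longlonglongrightarrow> 0"

definition convergent_family :: "(nat \<Rightarrow> (nat \<times> nat) set set) \<Rightarrow> bool" where
  "convergent_family T \<longleftrightarrow> (\<forall>d. convergent (\<lambda>n. degree_mass (grid_edges n) (T n) d))"

definition limit_mass :: "(nat \<Rightarrow> (nat \<times> nat) set set) \<Rightarrow> nat \<Rightarrow> real" where
  "limit_mass T d = lim (\<lambda>n. degree_mass (grid_edges n) (T n) d)"

definition assoc_series :: "(nat \<Rightarrow> (nat \<times> nat) set set) \<Rightarrow> real \<Rightarrow> real" where
  "assoc_series T x = 1 + x - (\<Sum>\<^sub>\<infinity>d\<in>{3..}. limit_mass T d * (1 - x) ^ d)"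

definition neighbor_independent :: "(nat \<Rightarrow> (nat \<times> nat) set set) \<Rightarrow> bool" where
  "neighbor_independent T \<longleftrightarrow>
     (\<lambda>n. real (card (neighboring_chord_pairs (grid_edges n) (T n))) /
          real (card (chord_pairs (grid_edges n) (T n)))) \<longlonglongrightarrow> 0"

text \<open>
  An associated power series is positive on \<open>(0, 1]\<close> but may vanish at \<open>0\<close> (when the limit masses
  sum to \<open>1\<close>); the value of the logarithm at that single point does not affect the integral.
\<close>

definition geometric_mean :: "(real \<Rightarrow> real) \<Rightarrow> real" where
  "geometric_mean f = exp (integral {0..1} (\<lambda>x. ln (f x)))"

end

theory Submission
  imports Defs "HOL-Real_Asymp.Real_Asymp"
begin

text \<open>
  The algorithm returns \<open>T\<close> exactly if every chord comes after all branches of its fundamental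
  cycle. Let \<open>N\<close> be the number of branches. For a fixed order \<open>\<beta>\<close> of the branches the remaining
  constraints form a forest, and the hook length formula gives the number of admissible orders of
  all edges as a factorial divided by \<open>\<Prod>\<^sub>k h\<^sub>k(\<beta>)\<close>, where \<open>h\<^sub>k(\<beta>)\<close> is \<open>k\<close> plus the number of chords
  whose cycle meets the last \<open>k\<close> branches. Hence \<open>Prob(T) = N! E[\<Prod>\<^sub>k 1/h\<^sub>k]\<close> for random \<open>\<beta>\<close>, and
  Jensen's inequality bounds this below by \<open>N! \<Prod>\<^sub>k 1/E[h\<^sub>k]\<close>. A chord of degree \<open>d\<close> misses the last
  \<open>x N\<close> branches with probability about \<open>(1 - x)\<^sup>d\<close>, so \<open>E[h\<^sub>k]/N\<close> is about \<open>f(k/N)\<close>; Stirling's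
  bound for \<open>N!\<close> and a Riemann sum for \<open>ln f\<close> finish the proof.
\<close>

subsection \<open>Cycles and spanning trees\<close>

text \<open>The relation inside \<open>connected_graph\<close>, named so that connectivity can be
  compared between different edge sets.\<close>

definition adj_rel :: "'a set set \<Rightarrow> ('a \<times> 'a) set" where
  "adj_rel F = {(x, y). {x, y} \<in> F}"

lemma adj_rel_mono: "F \<subseteq> F' \<Longrightarrow> adj_rel F \<subseteq> adj_rel F'"
  by (auto simp: adj_rel_def)

lemma adj_rel_rtrancl_sym: "(x, y) \<in> (adj_rel F)\<^sup>* \<Longrightarrow> (y, x) \<in> (adj_rel F)\<^sup>*"
proof -
  have "sym (adj_rel F)"
    by (auto simp: adj_rel_def sym_def insert_commute)
  then show "(x, y) \<in> (adj_rel F)\<^sup>* \<Longrightarrow> (y, x) \<in> (adj_rel F)\<^sup>*"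
    by (meson sym_rtrancl symD)
qed

text \<open>A walk becomes a path by induction from its front: if the new first vertex already
  occurs, the path is cut there.\<close>

lemma simple_path_exists:
  assumes "(u, v) \<in> (adj_rel F)\<^sup>*"
  shows "\<exists>vs. vs \<noteq> [] \<and> hd vs = u \<and> last vs = v \<and> distinct vs \<and>
           successively (\<lambda>x y. {x, y} \<in> F) vs"
  using assms
proof (induction rule: converse_rtrancl_induct)
  case base
  show ?case by (rule exI[of _ "[v]"]) simp
next
  case (step u w)
  then obtain vs where vs: "vs \<noteq> []" "hd vs = w" "last vs = v" "distinct vs"
      "successively (\<lambda>x y. {x, y} \<in> F) vs"
    by blast
  show ?case
  proof (cases "u \<in> set vs")
    case True
    then obtain xs ys where "vs = xs @ u # ys"
      by (meson split_list)
    then show ?thesis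
      using vs by (intro exI[of _ "u # ys"]) (auto simp: successively_append_iff)
  next
    case False
    then show ?thesis
      using vs step.hyps by (intro exI[of _ "u # vs"]) (auto simp: successively_Cons adj_rel_def)
  qed
qed

text \<open>A simple path from \<open>u\<close> to \<open>v\<close> has at least three vertices,
  since \<open>u\<close> and \<open>v\<close> are distinct and not joined in \<open>F\<close>. The
  wrap-around of the index in \<open>is_cycle\<close> supplies the closing edge.\<close>

lemma cycle_closing_path:
  assumes "(u, v) \<in> (adj_rel F)\<^sup>*" "u \<noteq> v" "{u, v} \<notin> F"
  shows "\<exists>C. is_cycle C \<and> C \<subseteq> insert {u, v} F"
proof -
  obtain vs where vs: "vs \<noteq> []" "hd vs = u" "last vs = v" "distinct vs"
      "successively (\<lambda>x y. {x, y} \<in> F) vs"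
    using simple_path_exists[OF assms(1)] by blast
  have len: "length vs \<ge> 3"
  proof (rule ccontr)
    assume "\<not> length vs \<ge> 3"
    moreover have "length vs \<noteq> 0"
      using vs(1) by simp
    ultimately consider "length vs = 1" | "length vs = 2"
      by linarith
    then show False
    proof cases
      case 1
      then show ?thesis using vs assms(2) by (auto simp: length_Suc_conv)
    next
      case 2
      then obtain a b where "vs = [a, b]"
        by (auto simp: length_Suc_conv numeral_2_eq_2)
      then show ?thesis using vs assms(3) by auto
    qed
  qed
  let ?C = "{{vs ! i, vs ! (Suc i mod length vs)} | i. i < length vs}"
  have "{vs ! i, vs ! (Suc i mod length vs)} \<in> insert {u, v} F" if "i < length vs" for i
  proof (cases "Suc i = length vs")
    case True
    then have "vs ! i = v" "vs ! (Suc i mod length vs) = u"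
      using vs by (simp_all add: hd_conv_nth last_conv_nth flip: True)
    then show ?thesis by (auto simp: insert_commute)
  next
    case False
    then show ?thesis
      using successively_nth[OF vs(5), of i] that by auto
  qed
  then have "?C \<subseteq> insert {u, v} F"
    by blast
  moreover have "is_cycle ?C"
    unfolding is_cycle_def using len vs(4) by blast
  ultimately show ?thesis by blast
qed

lemma cycle_edge_proper:
  assumes "is_cycle C" "c \<in> C"
  shows "\<exists>x y. x \<noteq> y \<and> c = {x, y}"
proof -
  obtain vs i where vs: "length vs \<ge> 3" "distinct vs" "i < length vs"
      "c = {vs ! i, vs ! (Suc i mod length vs)}"
    using assms by (auto simp: is_cycle_def)
  have "Suc i mod length vs \<noteq> i"
  proof (cases "Suc i = length vs")
    case True
    then show ?thesis using vs(1) by simp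
  next
    case False
    then show ?thesis using vs(3) by simp
  qed
  then have "vs ! i \<noteq> vs ! (Suc i mod length vs)"
    using vs nth_eq_iff_index_eq[OF vs(2), of i "Suc i mod length vs"]
      mod_less_divisor[of "length vs" "Suc i"] by linarith
  then show ?thesis using vs(4) by blast
qed

text \<open>The remaining edges lead around the cycle the other way.\<close>

lemma cycle_minus_edge_connects:
  assumes "is_cycle C" "{u, v} \<in> C"
  shows "(u, v) \<in> (adj_rel (C - {{u, v}}))\<^sup>*"
proof -
  obtain vs where vs: "length vs \<ge> 3" "distinct vs"
      "C = {{vs ! i, vs ! (Suc i mod length vs)} | i. i < length vs}"
    using assms(1) by (auto simp: is_cycle_def)
  define L where "L = length vs"
  obtain j where j: "j < L" "{u, v} = {vs ! j, vs ! (Suc j mod L)}"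
    using assms(2) vs(3) by (auto simp: L_def)
  let ?R = "(adj_rel (C - {{u, v}}))\<^sup>*"
  have nth_eq: "vs ! a = vs ! b \<longleftrightarrow> a = b" if "a < L" "b < L" for a b
    using vs(2) that by (simp add: nth_eq_iff_index_eq L_def)
  have edge: "(vs ! i, vs ! (Suc i mod L)) \<in> adj_rel (C - {{u, v}})" if "i < L" "i \<noteq> j" for i
  proof -
    have "{vs ! i, vs ! (Suc i mod L)} \<noteq> {vs ! j, vs ! (Suc j mod L)}"
    proof
      assume eq: "{vs ! i, vs ! (Suc i mod L)} = {vs ! j, vs ! (Suc j mod L)}"
      have "Suc i mod L < L" "Suc j mod L < L"
        using that by auto
      \<comment> \<open>The vertices being distinct, equal edges at \<open>i\<close> and
        \<open>j\<close> would have to be traversed in opposite directions, which only a closed walk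
        of length 2 permits.\<close>
      then have "i = Suc j mod L \<and> Suc i mod L = j"
        using eq that j(1) by (auto simp: doubleton_eq_iff nth_eq)
      moreover have "L \<ge> 3"
        using vs(1) by (simp add: L_def)
      ultimately show False
        using that j(1) by (cases "Suc j < L"; cases "Suc i < L") (auto simp: mod_if)
    qed
    then show ?thesis
      using that vs(3) j(2) by (auto simp: adj_rel_def L_def)
  qed
  have "(vs ! (Suc j mod L), vs ! ((Suc j + i) mod L)) \<in> ?R" if "i < L" for i
    using that
  proof (induction i)
    case (Suc i)
    have "(Suc j + i) mod L \<noteq> j"
      using Suc.prems j(1) by (cases "Suc j + i < L") (auto simp: le_mod_geq)
    moreover have "Suc ((Suc j + i) mod L) mod L = (Suc j + Suc i) mod L"
      by (simp add: mod_Suc_eq)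
    moreover have "(Suc j + i) mod L < L"
      using Suc.prems by simp
    ultimately have "(vs ! ((Suc j + i) mod L), vs ! ((Suc j + Suc i) mod L)) \<in> adj_rel (C - {{u, v}})"
      using edge[of "(Suc j + i) mod L"] by simp
    then show ?case
      using Suc by (meson Suc_lessD rtrancl.rtrancl_into_rtrancl)
  qed simp
  \<comment> \<open>Starting at the end \<open>Suc j\<close> of the removed edge,
    \<open>L - 1\<close> steps arrive at its other end \<open>j\<close>.\<close>
  from this[of "L - 1"] have "(vs ! (Suc j mod L), vs ! j) \<in> ?R"
    using j(1) by simp
  moreover have "u = vs ! j \<and> v = vs ! (Suc j mod L) \<or> u = vs ! (Suc j mod L) \<and> v = vs ! j"
    using j(2) by (simp add: doubleton_eq_iff)
  ultimately show ?thesis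
    by (auto intro: adj_rel_rtrancl_sym)
qed

text \<open>A path around the edge would close up to a cycle inside \<open>F\<close>.\<close>

lemma acyclic_edge_is_bridge:
  assumes "acyclic_edges F" "{x, y} \<in> F" "x \<noteq> y"
  shows "(x, y) \<notin> (adj_rel (F - {{x, y}}))\<^sup>*"
proof
  assume "(x, y) \<in> (adj_rel (F - {{x, y}}))\<^sup>*"
  from cycle_closing_path[OF this assms(3)] obtain C
    where "is_cycle C" "C \<subseteq> insert {x, y} (F - {{x, y}})"
    by blast
  moreover have "insert {x, y} (F - {{x, y}}) = F"
    using assms(2) by blast
  ultimately show False
    using assms(1) by (auto simp: acyclic_edges_def)
qed

text \<open>The right-hand side does not depend on \<open>C\<close>: fundamental cycles are unique.\<close>

lemma cycle_in_insert_edge: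
  assumes "acyclic_edges T" "{u, v} \<notin> T" "is_cycle C" "C \<subseteq> insert {u, v} T"
  shows "C = insert {u, v} {b \<in> T. (u, v) \<notin> (adj_rel (T - {b}))\<^sup>*}"
proof -
  have e: "{u, v} \<in> C"
    using assms by (auto simp: acyclic_edges_def)
  have conn: "(u, v) \<in> (adj_rel (T - {b}))\<^sup>*" if "b \<notin> C" for b
  proof -
    have "adj_rel (C - {{u, v}}) \<subseteq> adj_rel (T - {b})"
      using that assms(4) by (intro adj_rel_mono) auto
    then show ?thesis
      using cycle_minus_edge_connects[OF assms(3) e] rtrancl_mono by blast
  qed
  have disconn: "(u, v) \<notin> (adj_rel (T - {b}))\<^sup>*" if "b \<in> C" "b \<in> T" for b
  proof
    assume uv: "(u, v) \<in> (adj_rel (T - {b}))\<^sup>*"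
    obtain x y where xy: "x \<noteq> y" "b = {x, y}"
      using cycle_edge_proper[OF assms(3) \<open>b \<in> C\<close>] by blast
    \<comment> \<open>The rest of the cycle is rerouted to avoid \<open>b\<close>: its branches
      stay, and the chord is replaced by the assumed connection of \<open>u\<close> and
      \<open>v\<close>. The ends of \<open>b\<close> are then joined without \<open>b\<close>,
      although \<open>b\<close> is a bridge.\<close>
    have "adj_rel (C - {{x, y}}) \<subseteq> (adj_rel (T - {b}))\<^sup>*"
    proof
      fix z assume "z \<in> adj_rel (C - {{x, y}})"
      then obtain p q where z: "z = (p, q)" "{p, q} \<in> C" "{p, q} \<noteq> b"
        by (auto simp: adj_rel_def xy)
      then consider "{p, q} \<in> T" | "{p, q} = {u, v}"
        using assms(4) by auto
      then show "z \<in> (adj_rel (T - {b}))\<^sup>*"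
      proof cases
        case 1
        then show ?thesis using z by (auto simp: adj_rel_def)
      next
        case 2
        then show ?thesis
          using z uv adj_rel_rtrancl_sym[OF uv] by (auto simp: doubleton_eq_iff)
      qed
    qed
    then have "(x, y) \<in> (adj_rel (T - {b}))\<^sup>*"
      using cycle_minus_edge_connects[OF assms(3), of x y] \<open>b \<in> C\<close> xy(2)
        rtrancl_subset_rtrancl by blast
    then show False
      using acyclic_edge_is_bridge[OF assms(1), of x y] xy \<open>b \<in> T\<close> by simp
  qed
  show ?thesis
    using e conn disconn assms(4) by blast
qed

text \<open>\<open>spanning_tree\<close> does not restrict the shape of the elements of
  \<open>E\<close>; this condition excludes loops and edges that leave \<open>V\<close>.\<close>

definition simple_edges :: "'a set \<Rightarrow> 'a set set \<Rightarrow> bool" where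
  "simple_edges V E \<longleftrightarrow> (\<forall>e\<in>E. \<exists>u\<in>V. \<exists>v\<in>V. u \<noteq> v \<and> e = {u, v})"

text \<open>Justifies the definite description: connectedness of the tree gives existence, and the
  explicit formula for the cycle gives uniqueness.\<close>

lemma fundamental_cycle:
  assumes "spanning_tree V E T" "simple_edges V E" "e \<in> E - T"
  shows "is_cycle (fundamental_cycle T e)" "fundamental_cycle T e \<subseteq> insert e T"
proof -
  obtain u v where uv: "u \<in> V" "v \<in> V" "u \<noteq> v" "e = {u, v}"
    using assms(2,3) by (auto simp: simple_edges_def)
  have "(u, v) \<in> (adj_rel T)\<^sup>*"
    using assms(1) uv by (auto simp: spanning_tree_def connected_graph_def adj_rel_def)
  then have "\<exists>C. is_cycle C \<and> C \<subseteq> insert e T"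
    using cycle_closing_path[of u v T] assms(3) uv by auto
  moreover have "C = C'"
    if "is_cycle C \<and> C \<subseteq> insert e T" "is_cycle C' \<and> C' \<subseteq> insert e T" for C C'
    using cycle_in_insert_edge[of T u v C] cycle_in_insert_edge[of T u v C'] that assms(1,3) uv(4)
    by (simp add: spanning_tree_def)
  ultimately have "\<exists>!C. is_cycle C \<and> C \<subseteq> insert e T"
    by blast
  then have "is_cycle (fundamental_cycle T e) \<and> fundamental_cycle T e \<subseteq> insert e T"
    unfolding fundamental_cycle_def by (rule theI')
  then show "is_cycle (fundamental_cycle T e)" "fundamental_cycle T e \<subseteq> insert e T"
    by simp_all
qed

section \<open>The algorithm on orders in which the branches come first\<close>

definition branches :: "'a set set \<Rightarrow> 'a set set \<Rightarrow> 'a set \<Rightarrow> 'a set set" where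
  "branches E T e = {b. (b, e) \<in> bip_edges E T}"

text \<open>\<open>B x\<close> is read as the set of elements that must precede \<open>x\<close>.
  Only a late occurrence is forbidden, so members of \<open>B x\<close> may be absent from the list;
  this makes the condition inherit to tails.\<close>

fun heeds :: "('b \<Rightarrow> 'b set) \<Rightarrow> 'b list \<Rightarrow> bool" where
  "heeds B [] \<longleftrightarrow> True"
| "heeds B (x # xs) \<longleftrightarrow> B x \<inter> set xs = {} \<and> heeds B xs"

lemma heeds_append_Cons: "heeds B (xs @ x # ys) \<Longrightarrow> B x \<inter> set ys = {}"
  by (induction xs) auto

text \<open>Invariant: after each prefix exactly the branches seen so far are selected. A branch is
  accepted because \<open>T\<close> is acyclic; a chord is rejected because all other edges of its
  fundamental cycle have already been selected.\<close>

lemma kruskal_eq_spanning_tree: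
  assumes "spanning_tree V E T" "simple_edges V E"
    and es: "set es = E" "heeds (branches E T) es"
  shows "kruskal es = T"
proof -
  have "foldl kruskal_step {} xs = T \<inter> set xs" if "es = xs @ ys" for xs ys
    using that
  proof (induction xs arbitrary: ys rule: rev_induct)
    case (snoc x xs)
    have acyc: "acyclic_edges T" and "T \<subseteq> E"
      using assms(1) by (auto simp: spanning_tree_def)
    have IH: "foldl kruskal_step {} xs = T \<inter> set xs"
      using snoc by simp
    have step: "foldl kruskal_step {} (xs @ [x]) = kruskal_step (T \<inter> set xs) x"
      by (simp add: IH)
    show ?case
    proof (cases "x \<in> T")
      case True
      then have "acyclic_edges (insert x (T \<inter> set xs))"
        using acyc unfolding acyclic_edges_def by blast
      then show ?thesis
        unfolding step using True by (simp add: kruskal_step_def)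
    next
      case False
      have "x \<in> E - T"
        using False snoc.prems es(1) by auto
      note C = fundamental_cycle[OF assms(1,2) this]
      have "fundamental_cycle T x \<subseteq> insert x (T \<inter> set xs)"
      proof
        fix b assume b: "b \<in> fundamental_cycle T x"
        show "b \<in> insert x (T \<inter> set xs)"
        proof (cases "b = x")
          case False
          then have "b \<in> T"
            using b C by blast
          then have "b \<in> branches E T x"
            using b \<open>x \<in> E - T\<close> by (auto simp: branches_def bip_edges_def)
          then have "b \<notin> set ys"
            using es(2) snoc.prems by (auto dest: heeds_append_Cons)
          then show ?thesis
            using False \<open>b \<in> T\<close> \<open>T \<subseteq> E\<close> snoc.prems es(1) by auto
        qed simp
      qed
      then have "\<not> acyclic_edges (insert x (T \<inter> set xs))"
        using C(1) by (auto simp: acyclic_edges_def)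
      then show ?thesis
        unfolding step using False by (simp add: kruskal_step_def)
    qed
  qed simp
  from this[of es "[]"] have "kruskal es = T \<inter> E"
    by (simp add: kruskal_def es)
  then show ?thesis
    using assms(1) by (auto simp: spanning_tree_def)
qed

section \<open>The number of branches of a spanning tree\<close>

lemma rtrancl_leaves_set:
  assumes "(u, v) \<in> R\<^sup>*" "u \<in> A" "v \<notin> A"
  shows "\<exists>x\<in>A. \<exists>y. y \<notin> A \<and> (x, y) \<in> R"
  using assms by (induction rule: rtrancl_induct) auto

text \<open>A connected vertex set is grown from a root one vertex at a time; each new vertex brings
  exactly one new branch.\<close>

lemma card_spanning_tree:
  assumes "spanning_tree V E T" "simple_edges V E" "finite V"
  shows "card T = card V - 1"
proof -
  have T: "T \<subseteq> E" "acyclic_edges T" "V \<noteq> {}"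
    using assms(1) by (auto simp: spanning_tree_def connected_graph_def)
  have conn: "(u, v) \<in> (adj_rel T)\<^sup>*" if "u \<in> V" "v \<in> V" for u v
    using assms(1) that by (auto simp: spanning_tree_def connected_graph_def adj_rel_def)
  have edge: "\<exists>u\<in>V. \<exists>v\<in>V. u \<noteq> v \<and> e = {u, v}" if "e \<in> T" for e
    using assms(2) that T(1) by (auto simp: simple_edges_def)
  have "T \<subseteq> Pow V"
    using edge by auto
  then have fin: "finite T"
    using assms(3) finite_subset by auto
  obtain r where r: "r \<in> V" using T(3) by blast
  \<comment> \<open>\<open>T \<inter> Pow A\<close> consists of the branches with both ends in
    \<open>A\<close>.\<close>
  have grow: "\<exists>A. r \<in> A \<and> A \<subseteq> V \<and> card A = Suc j \<and> card (T \<inter> Pow A) = j \<and>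
          (\<forall>a\<in>A. \<forall>b\<in>A. (a, b) \<in> (adj_rel (T \<inter> Pow A))\<^sup>*)"
    if "j < card V" for j
    using that
  proof (induction j)
    case 0
    have "T \<inter> Pow {r} = {}"
      using edge by fastforce
    then show ?case
      using r by (intro exI[of _ "{r}"]) simp
  next
    case (Suc j)
    then obtain A where A: "r \<in> A" "A \<subseteq> V" "card A = Suc j" "card (T \<inter> Pow A) = j"
        and Aconn: "\<And>a b. a \<in> A \<Longrightarrow> b \<in> A \<Longrightarrow> (a, b) \<in> (adj_rel (T \<inter> Pow A))\<^sup>*"
      by auto
    have finA: "finite A"
      using A(2) assms(3) finite_subset by blast
    have "A \<noteq> V"
      using A(3) Suc.prems by auto
    then obtain w0 where w0: "w0 \<in> V" "w0 \<notin> A"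
      using A(2) by blast
    obtain a w where aw: "a \<in> A" "w \<notin> A" "{a, w} \<in> T"
      using rtrancl_leaves_set[OF conn[OF r w0(1)] A(1) w0(2)] by (auto simp: adj_rel_def)
    have "w \<in> V"
      using edge[OF aw(3)] by (auto simp: doubleton_eq_iff)
    \<comment> \<open>A second branch from \<open>A\<close> to \<open>w\<close> would not be a
      bridge: its ends are joined inside \<open>A\<close> and through \<open>{a, w}\<close>.\<close>
    have uniq: "a' = a" if "a' \<in> A" "{a', w} \<in> T" for a'
    proof (rule ccontr)
      assume "a' \<noteq> a"
      have "T \<inter> Pow A \<subseteq> T - {{a', w}}"
        using aw(2) by auto
      then have "(a', a) \<in> (adj_rel (T - {{a', w}}))\<^sup>*"
        using Aconn[OF that(1) aw(1)] rtrancl_mono[OF adj_rel_mono] by blast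
      moreover have "(a, w) \<in> adj_rel (T - {{a', w}})"
        using aw \<open>a' \<noteq> a\<close> by (auto simp: adj_rel_def doubleton_eq_iff)
      ultimately have "(a', w) \<in> (adj_rel (T - {{a', w}}))\<^sup>*"
        by (rule rtrancl.rtrancl_into_rtrancl)
      moreover have "a' \<noteq> w"
        using that aw by auto
      ultimately show False
        using acyclic_edge_is_bridge[OF T(2) that(2)] by blast
    qed
    have ins: "T \<inter> Pow (insert w A) = insert {a, w} (T \<inter> Pow A)"
    proof
      show "T \<inter> Pow (insert w A) \<subseteq> insert {a, w} (T \<inter> Pow A)"
      proof
        fix e assume e: "e \<in> T \<inter> Pow (insert w A)"
        obtain x y where xy: "x \<noteq> y" "e = {x, y}"
          using edge[of e] e by auto
        show "e \<in> insert {a, w} (T \<inter> Pow A)"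
        proof (cases "w \<in> e")
          case True
          then obtain a' where "e = {a', w}" "a' \<noteq> w"
            using xy by (cases "x = w") auto
          then show ?thesis using e uniq[of a'] by auto
        next
          case False
          then show ?thesis using e by auto
        qed
      qed
      show "insert {a, w} (T \<inter> Pow A) \<subseteq> T \<inter> Pow (insert w A)"
        using aw by auto
    qed
    have "card (T \<inter> Pow (insert w A)) = Suc j"
      using A(4) aw(2) fin by (subst ins) (subst card_insert_disjoint, auto)
    moreover have "card (insert w A) = Suc (Suc j)"
      using A(3) aw(2) finA by simp
    moreover have "(p, q) \<in> (adj_rel (T \<inter> Pow (insert w A)))\<^sup>*"
      if "p \<in> insert w A" "q \<in> insert w A" for p q
    proof -
      have to_a: "(z, a) \<in> (adj_rel (T \<inter> Pow (insert w A)))\<^sup>*" if "z \<in> insert w A" for z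
      proof (cases "z = w")
        case True
        then have "(z, a) \<in> adj_rel (T \<inter> Pow (insert w A))"
          using aw by (auto simp: adj_rel_def insert_commute)
        then show ?thesis by blast
      next
        case False
        then have "(z, a) \<in> (adj_rel (T \<inter> Pow A))\<^sup>*"
          using that Aconn aw(1) by blast
        then show ?thesis
          using rtrancl_mono[OF adj_rel_mono, of "T \<inter> Pow A" "T \<inter> Pow (insert w A)"] by blast
      qed
      show ?thesis
        using to_a[OF that(1)] adj_rel_rtrancl_sym[OF to_a[OF that(2)]] by (rule rtrancl_trans)
    qed
    ultimately show ?case
      using A \<open>w \<in> V\<close> by (intro exI[of _ "insert w A"]) auto
  qed
  have "card V \<ge> 1"
    using T(3) assms(3) by (simp add: Suc_leI card_gt_0_iff)
  then obtain A where A: "A \<subseteq> V" "card A = card V" "card (T \<inter> Pow A) = card V - 1"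
    using grow[of "card V - 1"] by auto
  then have "A = V"
    using assms(3) card_subset_eq by blast
  moreover have "T \<inter> Pow V = T"
    using edge by auto
  ultimately show ?thesis
    using A(3) by simp
qed

section \<open>Edges and chords of the grid\<close>

lemma dist_grid_eq_1_iff:
  "dist (real a, real b) (real c, real d) = 1 \<longleftrightarrow>
     (a = c \<and> (d = Suc b \<or> b = Suc d)) \<or> (b = d \<and> (c = Suc a \<or> a = Suc c))"
proof -
  have "dist (real a, real b) (real c, real d) = 1 \<longleftrightarrow>
      (real a - real c)\<^sup>2 + (real b - real d)\<^sup>2 = 1"
    by (simp add: dist_Pair_Pair dist_real_def)
  \<comment> \<open>Over the integers, two squares with sum 1 must be 0 and 1.\<close>
  also have "\<dots> \<longleftrightarrow> of_int ((int a - int c)\<^sup>2 + (int b - int d)\<^sup>2) = (of_int 1 :: real)"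
    by simp
  also have "\<dots> \<longleftrightarrow> (int a - int c)\<^sup>2 + (int b - int d)\<^sup>2 = 1"
    by (rule of_int_eq_iff)
  also have "\<dots> \<longleftrightarrow> (a = c \<and> (d = Suc b \<or> b = Suc d)) \<or> (b = d \<and> (c = Suc a \<or> a = Suc c))"
  proof
    assume *: "(int a - int c)\<^sup>2 + (int b - int d)\<^sup>2 = 1"
    have sq: "z\<^sup>2 = 0 \<and> z = 0 \<or> z\<^sup>2 = 1 \<and> \<bar>z\<bar> = 1 \<or> z\<^sup>2 > 1" for z :: int
      using abs_square_less_1[of z] abs_square_eq_1[of z] by (cases "z\<^sup>2 > 1") force+
    show "(a = c \<and> (d = Suc b \<or> b = Suc d)) \<or> (b = d \<and> (c = Suc a \<or> a = Suc c))"
      using sq[of "int a - int c"] sq[of "int b - int d"] * by auto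
  qed auto
  finally show ?thesis .
qed

text \<open>Parametrises every edge exactly once, by its endpoint with the smaller coordinates, so
  that the edges can be counted.\<close>

lemma grid_edges_eq:
  "grid_edges n = (\<lambda>(a, b). {(a, b), (a, Suc b)}) ` ({1..n} \<times> {1..<n}) \<union>
                  (\<lambda>(a, b). {(a, b), (Suc a, b)}) ` ({1..<n} \<times> {1..n})" (is "_ = ?H \<union> ?V")
proof
  show "grid_edges n \<subseteq> ?H \<union> ?V"
  proof
    fix e assume "e \<in> grid_edges n"
    then obtain a b c d where e: "e = {(a, b), (c, d)}" "a \<in> {1..n}" "b \<in> {1..n}"
        "c \<in> {1..n}" "d \<in> {1..n}" "dist (real a, real b) (real c, real d) = 1"
      by (auto simp: grid_edges_def grid_vertices_def)
    from e(6) consider "a = c" "d = Suc b" | "a = c" "b = Suc d" | "b = d" "c = Suc a" | "b = d" "a = Suc c"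
      by (auto simp: dist_grid_eq_1_iff)
    then show "e \<in> ?H \<union> ?V"
    proof cases
      case 1 then have "e \<in> ?H" using e by (intro image_eqI[of _ _ "(a, b)"]) auto
      then show ?thesis by simp
    next
      case 2 then have "e \<in> ?H" using e by (intro image_eqI[of _ _ "(a, d)"]) auto
      then show ?thesis by simp
    next
      case 3 then have "e \<in> ?V" using e by (intro image_eqI[of _ _ "(a, b)"]) auto
      then show ?thesis by simp
    next
      case 4 then have "e \<in> ?V" using e by (intro image_eqI[of _ _ "(c, b)"]) auto
      then show ?thesis by simp
    qed
  qed
  have "{(a, b), (c, d)} \<in> grid_edges n"
    if "a \<in> {1..n}" "b \<in> {1..n}" "c \<in> {1..n}" "d \<in> {1..n}"
       "dist (real a, real b) (real c, real d) = 1" for a b c d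
    using that unfolding grid_edges_def grid_vertices_def by blast
  then show "?H \<union> ?V \<subseteq> grid_edges n"
    by (auto simp: dist_grid_eq_1_iff)
qed

lemma finite_grid_edges: "finite (grid_edges n)"
  by (simp add: grid_edges_eq)

lemma card_grid_edges: "card (grid_edges n) = 2 * n * (n - 1)"
proof -
  let ?h = "\<lambda>(a :: nat, b :: nat). {(a, b), (a, Suc b)}"
  let ?v = "\<lambda>(a :: nat, b :: nat). {(a, b), (Suc a, b)}"
  have h: "{(a, b), (a, Suc b)} = {(c, d), (c, Suc d)} \<longleftrightarrow> a = c \<and> b = d"
    and v: "{(a, b), (Suc a, b)} = {(c, d), (Suc c, d)} \<longleftrightarrow> a = c \<and> b = d"
    and hv: "{(a, b), (a, Suc b)} \<noteq> {(c, d), (Suc c, d)}" for a b c d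
    unfolding doubleton_eq_iff prod.inject by linarith+
  have "inj_on ?h X" "inj_on ?v X" for X
    unfolding inj_on_def case_prod_unfold h v by (simp_all add: prod_eq_iff)
  then have "card (?h ` ({1..n} \<times> {1..<n})) = n * (n - 1)"
       "card (?v ` ({1..<n} \<times> {1..n})) = (n - 1) * n"
    by (simp_all add: card_image)
  moreover have "?h ` ({1..n} \<times> {1..<n}) \<inter> ?v ` ({1..<n} \<times> {1..n}) = {}"
    unfolding disjoint_iff image_iff case_prod_unfold using hv by metis
  ultimately show ?thesis
    unfolding grid_edges_eq by (subst card_Un_disjoint) auto
qed

lemma simple_edges_grid: "simple_edges (grid_vertices n) (grid_edges n)"
  unfolding simple_edges_def
proof
  fix e assume "e \<in> grid_edges n"
  then obtain a b c d where "e = {(a, b), (c, d)}" "(a, b) \<in> grid_vertices n"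
      "(c, d) \<in> grid_vertices n" "dist (real a, real b) (real c, real d) = 1"
    by (auto simp: grid_edges_def)
  moreover have "(a, b) \<noteq> (c, d)"
    using calculation(4) by auto
  ultimately show "\<exists>u\<in>grid_vertices n. \<exists>v\<in>grid_vertices n. u \<noteq> v \<and> e = {u, v}"
    by blast
qed

lemma card_grid_spanning_tree:
  assumes "spanning_tree (grid_vertices n) (grid_edges n) T"
  shows "card T = n\<^sup>2 - 1"
  using card_spanning_tree[OF assms simple_edges_grid]
  by (simp add: grid_vertices_def card_cartesian_product power2_eq_square)

text \<open>\<open>2n(n-1) - (n^2-1) = (n-1)^2\<close>, the number of unit squares of the
  grid.\<close>

lemma card_grid_chords:
  assumes "spanning_tree (grid_vertices n) (grid_edges n) T" "n \<ge> 1"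
  shows "card (grid_edges n - T) = (n - 1)\<^sup>2"
proof -
  have "T \<subseteq> grid_edges n"
    using assms(1) by (simp add: spanning_tree_def)
  then have "card (grid_edges n - T) = 2 * n * (n - 1) - (n\<^sup>2 - 1)"
    using card_grid_spanning_tree[OF assms(1)] finite_grid_edges[of n]
    by (simp add: card_Diff_subset finite_subset card_grid_edges)
  also have "\<dots> = (n - 1)\<^sup>2"
    using assms(2) by (cases n) (auto simp: power2_eq_square algebra_simps)
  finally show ?thesis .
qed

subsection \<open>Orders in which the branches precede their chords\<close>

text \<open>The filter condition prescribes the relative order \<open>bs\<close> of the branches
  still to come; \<open>S\<close> holds the chords still to be placed.\<close>

definition heeding_lists :: "('b \<Rightarrow> 'b set) \<Rightarrow> 'b set \<Rightarrow> 'b list \<Rightarrow> 'b set \<Rightarrow> 'b list set" where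
  "heeding_lists B T bs S =
     {es. set es = set bs \<union> S \<and> distinct es \<and> filter (\<lambda>x. x \<in> T) es = bs \<and> heeds B es}"

text \<open>In the forest of constraints \<open>bs\<close> is a chain and each chord hangs below the
  last of its branches. This is the size of the subtree rooted at the first entry of
  \<open>bs\<close>; for later entries it is applied to suffixes of \<open>bs\<close>.\<close>

definition hook :: "('b \<Rightarrow> 'b set) \<Rightarrow> 'b set \<Rightarrow> 'b list \<Rightarrow> nat" where
  "hook B S bs = length bs + card {s \<in> S. B s \<inter> set bs \<noteq> {}}"

lemma hook_pos: "bs \<noteq> [] \<Longrightarrow> hook B S bs > 0"
  by (simp add: hook_def)

text \<open>The recursion behind the count: the first entry is either a chord with no pending branch
  or the next branch of the prescribed order.\<close>

lemma Cons_in_heeding_lists_iff: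
  assumes "distinct bs" "set bs \<subseteq> T" "S \<inter> T = {}" "\<And>x. x \<in> T \<Longrightarrow> B x = {}" "\<And>s. B s \<subseteq> T"
  shows "x # es \<in> heeding_lists B T bs S \<longleftrightarrow>
     x \<in> S \<and> B x \<inter> set bs = {} \<and> es \<in> heeding_lists B T bs (S - {x}) \<or>
     (\<exists>bs'. bs = x # bs' \<and> es \<in> heeding_lists B T bs' S)"
proof (cases "x \<in> T")
  case True
  then have "x \<notin> S" "B x = {}" using assms by auto
  then show ?thesis
    using True assms(1) by (cases bs) (auto simp: heeding_lists_def)
next
  case False
  then have "x \<notin> set bs" using assms by auto
  have "x \<notin> set es \<and> insert x (set es) = set bs \<union> S \<longleftrightarrow> x \<in> S \<and> set es = set bs \<union> (S - {x})"
    (is "?L \<longleftrightarrow> ?R")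
  proof
    assume L: ?L
    then have "x \<in> set bs \<union> S" by (metis insertI1)
    moreover have "set es = (set bs \<union> S) - {x}"
      using L by (metis Diff_insert_absorb)
    ultimately show ?R
      using \<open>x \<notin> set bs\<close> by (simp add: Un_Diff)
  next
    assume ?R
    then show ?L using \<open>x \<notin> set bs\<close> by (simp add: insert_Diff insert_absorb flip: Un_insert_right)
  qed
  moreover have "B x \<inter> set es = {} \<longleftrightarrow> B x \<inter> set bs = {}" if "set es = set bs \<union> (S - {x})"
    using that assms(3) assms(5)[of x] by auto
  moreover have "bs \<noteq> x # bs'" for bs'
    using \<open>x \<notin> set bs\<close> by auto
  ultimately show ?thesis
    using False by (simp add: heeding_lists_def) blast
qed

lemma finite_heeding_lists:
  assumes "finite S"
  shows "finite (heeding_lists B T bs S)"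
proof (rule finite_subset)
  show "heeding_lists B T bs S \<subseteq> permutations_of_set (set bs \<union> S)"
    by (auto simp: heeding_lists_def permutations_of_set_def)
qed simp

text \<open>Once the order \<open>bs\<close> of the branches is fixed, the precedence constraints form a forest, so
  this is an instance of the hook length formula.\<close>

lemma card_heeding_lists:
  assumes "distinct bs" "set bs \<subseteq> T" "finite S" "S \<inter> T = {}"
    and "\<And>x. x \<in> T \<Longrightarrow> B x = {}" "\<And>s. B s \<subseteq> T"
  shows "real (card (heeding_lists B T bs S)) =
           fact (length bs + card S) / (\<Prod>i<length bs. real (hook B S (drop i bs)))"
  using assms(1-4)
proof (induction "length bs + card S" arbitrary: bs S)
  case 0
  then have "heeding_lists B T bs S = {[]}"
    by (auto simp: heeding_lists_def)
  then show ?case using 0 by simp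
next
  case (Suc n)
  let ?F = "{s \<in> S. B s \<inter> set bs = {}}"
  let ?H = "\<lambda>bs S. \<Prod>i<length bs. real (hook B S (drop i bs))"
  have fin: "finite ?F" "finite S" using Suc.prems by auto
  define X where "X = (\<Union>s\<in>?F. (#) s ` heeding_lists B T bs (S - {s}))"
  define Y where "Y = (case bs of [] \<Rightarrow> {} | b # bs' \<Rightarrow> (#) b ` heeding_lists B T bs' S)"
  have "[] \<notin> heeding_lists B T bs S"
    using Suc.hyps(2) by (auto simp: heeding_lists_def)
  have decomp: "heeding_lists B T bs S = X \<union> Y"
  proof (rule set_eqI)
    fix es
    show "es \<in> heeding_lists B T bs S \<longleftrightarrow> es \<in> X \<union> Y"
    proof (cases es)
      case Nil
      then show ?thesis
        using \<open>[] \<notin> _\<close> by (auto simp: X_def Y_def split: list.splits)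
    next
      case (Cons x xs)
      then show ?thesis
        using Cons_in_heeding_lists_iff[of bs T S B x xs] Suc.prems assms(5,6)
        by (auto simp: X_def Y_def split: list.splits)
    qed
  qed
  have finX: "finite X" "finite Y"
    using fin by (auto simp: X_def Y_def finite_heeding_lists split: list.splits)
  have "X \<inter> Y = {}"
    using Suc.prems(2,4) by (auto simp: X_def Y_def split: list.splits)
  then have card: "card (heeding_lists B T bs S) = card X + card Y"
    using decomp finX by (simp add: card_Un_disjoint)
  \<comment> \<open>A chord in \<open>?F\<close> meets no suffix of \<open>bs\<close>, so removing
    it leaves every hook unchanged.\<close>
  have IH_s: "real (card (heeding_lists B T bs (S - {s}))) = fact n / ?H bs S" if s: "s \<in> ?F" for s
  proof -
    have S': "card S = Suc (card (S - {s}))"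
      using s fin(2) by (metis (no_types, lifting) card.remove mem_Collect_eq)
    have hook: "hook B (S - {s}) (drop i bs) = hook B S (drop i bs)" for i
    proof -
      have "B s \<inter> set (drop i bs) = {}"
        using s set_drop_subset[of i bs] by blast
      then have "{t \<in> S - {s}. B t \<inter> set (drop i bs) \<noteq> {}} = {t \<in> S. B t \<inter> set (drop i bs) \<noteq> {}}"
        by blast
      then show ?thesis by (simp add: hook_def)
    qed
    have "n = length bs + card (S - {s})"
      using S' Suc.hyps(2) by simp
    then show ?thesis
      using Suc.hyps(1)[of bs "S - {s}"] Suc.prems by (auto simp: hook)
  qed
  have "card X = (\<Sum>s\<in>?F. card ((#) s ` heeding_lists B T bs (S - {s})))"
    unfolding X_def using fin by (subst card_UN_disjoint) (auto simp: finite_heeding_lists)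
  also have "\<dots> = (\<Sum>s\<in>?F. card (heeding_lists B T bs (S - {s})))"
    by (intro sum.cong refl card_image) auto
  finally have cardX: "real (card X) = real (card ?F) * (fact n / ?H bs S)"
    using IH_s by simp
  show ?case
  proof (cases bs)
    case Nil
    then have "?F = S" "card Y = 0" by (auto simp: Y_def)
    moreover have "Suc n = card S" using Suc.hyps(2) Nil by simp
    ultimately show ?thesis
      using card cardX Nil by (simp flip: \<open>Suc n = card S\<close>)
  next
    case (Cons b bs')
    have "real (card Y) = real (card (heeding_lists B T bs' S))"
      using Cons by (simp add: Y_def card_image)
    also have "\<dots> = fact n / ?H bs' S"
      using Suc.hyps(1)[of bs' S] Suc.hyps(2) Suc.prems Cons by simp
    finally have cardY: "real (card Y) = fact n / ?H bs' S" .
    have H: "?H bs S = real (hook B S bs) * ?H bs' S"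
      by (simp add: Cons prod.lessThan_Suc_shift del: prod.lessThan_Suc)
    have pos: "real (hook B S bs) > 0" "?H bs' S > 0"
      using Cons by (auto intro!: prod_pos simp: hook_pos)
    have "card S = card {s \<in> S. B s \<inter> set bs \<noteq> {}} + card ?F"
      using fin by (subst card_Un_disjoint[symmetric]) (auto intro!: arg_cong[of _ _ card])
    \<comment> \<open>The elements to be placed are the subtree below the first branch and the free
      chords. These two summands match the orders starting with that branch and with a free
      chord.\<close>
    then have "real (Suc n) = real (hook B S bs) + real (card ?F)"
      using Suc.hyps(2) by (simp add: hook_def)
    then have "fact (Suc n) / ?H bs S = (real (hook B S bs) + real (card ?F)) * fact n / ?H bs S"
      by simp
    also have "\<dots> = real (card X) + real (card Y)"
    proof -
      have "(a + f) * c / (a * P) = f * (c / (a * P)) + c / P" if "a > 0" "P > 0" for a f c P :: real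
        using that by (simp add: field_simps)
      from this[OF pos] show ?thesis
        unfolding cardX cardY H .
    qed
    finally show ?thesis
      using card Suc.hyps(2) by simp
  qed
qed

text \<open>Jensen's inequality for \<open>exp\<close> and for \<open>ln\<close>, obtained from the tangent-line bounds
  \<open>exp y \<ge> 1 + y\<close> and \<open>ln y \<le> y - 1\<close>.\<close>

lemma sum_prod_inverse_ge:
  fixes h :: "'i \<Rightarrow> 'b \<Rightarrow> real"
  assumes "finite \<Omega>" "finite I"
    and h: "\<And>i b. i \<in> I \<Longrightarrow> b \<in> \<Omega> \<Longrightarrow> h i b > 0"
    and m: "\<And>i. i \<in> I \<Longrightarrow> m i > 0"
    and mean: "\<And>i. i \<in> I \<Longrightarrow> (\<Sum>b\<in>\<Omega>. h i b) \<le> real (card \<Omega>) * m i"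
  shows "(\<Sum>b\<in>\<Omega>. \<Prod>i\<in>I. 1 / h i b) \<ge> real (card \<Omega>) * (\<Prod>i\<in>I. 1 / m i)"
proof -
  \<comment> \<open>Both tangent lines are taken at the point where every \<open>h i b\<close>
    equals \<open>m i\<close>.\<close>
  have tangent: "(\<Prod>i\<in>I. m i / h i b) \<ge> 1 + (\<Sum>i\<in>I. 1 - h i b / m i)" if "b \<in> \<Omega>" for b
  proof -
    have "1 + (\<Sum>i\<in>I. 1 - h i b / m i) \<le> 1 + (\<Sum>i\<in>I. ln (m i / h i b))"
    proof (intro add_left_mono sum_mono)
      fix i assume "i \<in> I"
      then have "ln (h i b / m i) \<le> h i b / m i - 1"
        using h m that by (intro ln_le_minus_one) auto
      moreover have "ln (m i / h i b) = - ln (h i b / m i)"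
        using h m that \<open>i \<in> I\<close> by (simp add: ln_div)
      ultimately show "1 - h i b / m i \<le> ln (m i / h i b)" by simp
    qed
    also have "\<dots> \<le> exp (\<Sum>i\<in>I. ln (m i / h i b))"
      by (rule exp_ge_add_one_self)
    also have "\<dots> = (\<Prod>i\<in>I. m i / h i b)"
      using h m that by (simp add: exp_sum assms(2))
    finally show ?thesis .
  qed
  have "(\<Sum>b\<in>\<Omega>. \<Sum>i\<in>I. 1 - h i b / m i) = (\<Sum>i\<in>I. real (card \<Omega>) - (\<Sum>b\<in>\<Omega>. h i b) / m i)"
    by (subst sum.swap) (simp add: sum_subtractf sum_divide_distrib)
  \<comment> \<open>The bounds \<open>m i\<close> on the means make the linear correction
    nonnegative after summation over \<open>\<Omega>\<close>.\<close>
  also have "\<dots> \<ge> 0"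
    using m mean by (intro sum_nonneg) (auto simp: field_simps)
  finally have "real (card \<Omega>) \<le> (\<Sum>b\<in>\<Omega>. 1 + (\<Sum>i\<in>I. 1 - h i b / m i))"
    by (simp add: sum.distrib)
  also have "\<dots> \<le> (\<Sum>b\<in>\<Omega>. \<Prod>i\<in>I. m i / h i b)"
    by (intro sum_mono tangent)
  also have "\<dots> = (\<Prod>i\<in>I. m i) * (\<Sum>b\<in>\<Omega>. \<Prod>i\<in>I. 1 / h i b)"
    by (simp add: sum_distrib_left prod_dividef)
  finally show ?thesis
    using m by (simp add: prod_dividef prod_pos pos_divide_le_eq mult.commute)
qed

text \<open>The probability that the first \<open>k\<close> entries of a random permutation of \<open>N\<close> elements avoid
  \<open>d\<close> given ones.\<close>

definition avoid_prob :: "nat \<Rightarrow> nat \<Rightarrow> nat \<Rightarrow> real" where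
  "avoid_prob N k d =
     (if d + k \<le> N then fact (N - d) * fact (N - k) / (fact (N - d - k) * fact N) else 0)"

text \<open>Induction on \<open>k\<close>, with any of the \<open>card W - card D\<close> permitted
  elements as first entry. The product form avoids division of natural numbers.\<close>

lemma card_permutations_avoiding:
  assumes "finite W" "D \<subseteq> W" "k + card D \<le> card W"
  shows "card {bs \<in> permutations_of_set W. set (take k bs) \<inter> D = {}} * fact (card W - card D - k) =
           (fact (card W - card D) * fact (card W - k) :: nat)"
  using assms
proof (induction k arbitrary: W)
  case (Suc k)
  let ?A = "\<lambda>W k. {bs \<in> permutations_of_set W. set (take k bs) \<inter> D = {}}"
  have decomp: "?A W (Suc k) = (\<Union>x\<in>W - D. (#) x ` ?A (W - {x}) k)"
  proof -
    have "W \<noteq> {}" using Suc.prems by auto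
    then show ?thesis
      by (subst permutations_of_set_nonempty) auto
  qed
  have IH: "card (?A (W - {x}) k) * fact (card W - card D - Suc k) =
              fact (card W - card D - 1) * fact (card W - Suc k)" if "x \<in> W - D" for x
  proof -
    have "card (W - {x}) = card W - 1"
      using that Suc.prems(1) by simp
    moreover have "D \<subseteq> W - {x}" "k + card D \<le> card W - 1" "finite (W - {x})"
      using that Suc.prems by auto
    moreover have "card W - 1 - card D - k = card W - card D - Suc k"
      "card W - 1 - card D = card W - card D - 1" "card W - 1 - k = card W - Suc k"
      by simp_all
    ultimately show ?thesis
      using Suc.IH[of "W - {x}"] by (simp only:)
  qed
  have "card (?A W (Suc k)) = (\<Sum>x\<in>W - D. card ((#) x ` ?A (W - {x}) k))"
    unfolding decomp using Suc.prems(1) by (subst card_UN_disjoint) auto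
  also have "\<dots> = (\<Sum>x\<in>W - D. card (?A (W - {x}) k))"
    by (intro sum.cong refl card_image) auto
  finally have "card (?A W (Suc k)) * fact (card W - card D - Suc k) =
      card (W - D) * (fact (card W - card D - 1) * fact (card W - Suc k))"
    by (simp only: sum_distrib_right) (subst sum.cong[OF refl IH], simp_all)
  also have "card (W - D) = card W - card D"
    using Suc.prems finite_subset by (intro card_Diff_subset) auto
  also have "(card W - card D) * (fact (card W - card D - 1) * fact (card W - Suc k)) =
      (fact (card W - card D) * fact (card W - Suc k) :: nat)"
    using Suc.prems(3) by (simp add: fact_reduce[of "card W - card D"])
  finally show ?case .
qed simp

text \<open>Reversing the list turns the suffix into a prefix of length \<open>card W - i\<close>.
  Where \<open>avoid_prob\<close> has its default value 0 the bound is trivial.\<close>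

lemma card_permutations_suffix_avoiding:
  assumes "finite W" "D \<subseteq> W" "i \<le> card W"
  shows "real (card {bs \<in> permutations_of_set W. D \<inter> set (drop i bs) = {}}) \<ge>
           fact (card W) * avoid_prob (card W) (card W - i) (card D)"
proof (cases "card D + (card W - i) \<le> card W")
  case True
  let ?k = "card W - i"
  have "{bs \<in> permutations_of_set W. D \<inter> set (drop i bs) = {}} =
          rev ` {bs \<in> permutations_of_set W. set (take ?k bs) \<inter> D = {}}" (is "?L = rev ` ?R")
  proof -
    have "set (take ?k (rev bs)) = set (drop i bs)" if "bs \<in> permutations_of_set W" for bs
      using length_finite_permutations_of_set[OF that] assms(3) by (simp add: take_rev)
    moreover have "rev bs \<in> permutations_of_set W \<longleftrightarrow> bs \<in> permutations_of_set W" for bs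
      by (auto simp: permutations_of_set_def)
    ultimately have *: "bs \<in> ?L \<longleftrightarrow> rev bs \<in> ?R" for bs
      by blast
    show ?thesis
    proof (rule set_eqI)
      fix bs
      have "bs \<in> rev ` ?R \<longleftrightarrow> rev bs \<in> ?R"
        by (metis (no_types, lifting) image_iff rev_rev_ident)
      with * show "bs \<in> ?L \<longleftrightarrow> bs \<in> rev ` ?R" by blast
    qed
  qed
  then have "card ?L = card ?R"
    by (simp add: card_image)
  moreover have "real (card ?R) * fact (card W - card D - ?k) = fact (card W - card D) * fact (card W - ?k)"
  proof -
    have "card ?R * fact (card W - card D - ?k) = fact (card W - card D) * fact (card W - ?k)"
      using card_permutations_avoiding[OF assms(1,2), of ?k] True by (simp only: add.commute)
    from arg_cong[OF this, of real] show ?thesis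
      by (simp only: of_nat_mult of_nat_fact)
  qed
  ultimately show ?thesis
    using True by (simp add: avoid_prob_def field_simps)
qed (simp add: avoid_prob_def)

section \<open>Recursion and bounds for the avoidance probability\<close>

lemma avoid_prob_0: "k \<le> N \<Longrightarrow> avoid_prob N k 0 = 1"
  by (simp add: avoid_prob_def)

text \<open>Places the \<open>d\<close> given elements one by one: the next one has
  \<open>N - d\<close> positions left, \<open>N - d - k\<close> of them outside the first
  \<open>k\<close>. The factor vanishes at \<open>d + k = N\<close>, in agreement with the default
  value 0 beyond.\<close>

lemma avoid_prob_Suc:
  "avoid_prob N k (Suc d) = avoid_prob N k d * (real (N - d - k) / real (N - d))"
proof (cases "Suc d + k \<le> N")
  case True
  then have "fact (N - d) = real (N - d) * fact (N - Suc d)"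
    "fact (N - d - k) = real (N - d - k) * fact (N - Suc d - k)"
    by (subst fact_reduce; simp add: algebra_simps)+
  then show ?thesis
    using True by (simp add: avoid_prob_def)
qed (simp add: avoid_prob_def)

lemma avoid_prob_nonneg: "avoid_prob N k d \<ge> 0"
  by (simp add: avoid_prob_def)

text \<open>Compares sampling without and with replacement, factor by factor. The geometric bound
  later provides a summable majorant.\<close>

lemma avoid_prob_le_power:
  assumes "k \<le> N" "N > 0"
  shows "avoid_prob N k d \<le> (1 - real k / real N) ^ d"
proof (induction d)
  case 0
  show ?case using assms by (simp add: avoid_prob_0)
next
  case (Suc d)
  have "real (N - d - k) / real (N - d) \<le> 1 - real k / real N"
  proof (cases "d + k < N")
    case True
    then have "real (N - d - k) / real (N - d) = 1 - real k / real (N - d)"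
      by (simp add: field_simps of_nat_diff)
    moreover have "real k / real N \<le> real k / real (N - d)"
      using True by (intro divide_left_mono) auto
    ultimately show ?thesis by simp
  next
    case False
    then show ?thesis using assms by (simp add: field_simps)
  qed
  then show ?case
    unfolding avoid_prob_Suc power_Suc2
    using Suc.IH assms by (intro mult_mono) auto
qed

lemma avoid_prob_le_1:
  assumes "k \<le> N" "N > 0"
  shows "avoid_prob N k d \<le> 1"
proof -
  have "(1 - real k / real N) ^ d \<le> 1"
    using assms by (intro power_le_one) (auto simp: field_simps)
  then show ?thesis
    using avoid_prob_le_power[OF assms, of d] by simp
qed

text \<open>The mean, over a random order of the \<open>N\<close> branches, of the number of edges that are among
  the last \<open>k\<close> branches or are chords depending on one of these.\<close>

definition mean_hook :: "'a set set \<Rightarrow> 'a set set \<Rightarrow> nat \<Rightarrow> real" where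
  "mean_hook E T k = real k + (\<Sum>s\<in>E - T. 1 - avoid_prob (card T) k (bip_degree E T s))"

lemma mean_hook_ge:
  assumes "k \<le> card T" "card T > 0"
  shows "mean_hook E T k \<ge> real k"
  unfolding mean_hook_def using assms avoid_prob_le_1 by (auto intro!: sum_nonneg)

lemma bip_degree_chord:
  "s \<in> E - T \<Longrightarrow> bip_degree E T s = card (branches E T s)"
  unfolding bip_degree_def branches_def by (intro arg_cong[of _ _ card]) (auto simp: bip_edges_def)

text \<open>Linearity of expectation: the hook is the length \<open>card T - i\<close> of the suffix
  plus one indicator per chord, and the two sums are exchanged.\<close>

lemma sum_hook_le:
  assumes "finite E" "T \<subseteq> E" "i < card T"
  shows "(\<Sum>bs\<in>permutations_of_set T. real (hook (branches E T) (E - T) (drop i bs))) \<le>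
           fact (card T) * mean_hook E T (card T - i)"
proof -
  let ?\<Omega> = "permutations_of_set T" and ?B = "branches E T" and ?N = "card T"
  let ?R = "\<lambda>s. {bs \<in> ?\<Omega>. ?B s \<inter> set (drop i bs) = {}}"
  have fin: "finite T" "finite (E - T)"
    using assms finite_subset by auto
  have "(\<Sum>bs\<in>?\<Omega>. real (hook ?B (E - T) (drop i bs))) =
      (\<Sum>bs\<in>?\<Omega>. real (?N - i) + (\<Sum>s\<in>E - T. if ?B s \<inter> set (drop i bs) = {} then 0 else 1))"
  proof (intro sum.cong refl)
    fix bs assume "bs \<in> ?\<Omega>"
    then show "real (hook ?B (E - T) (drop i bs)) =
        real (?N - i) + (\<Sum>s\<in>E - T. if ?B s \<inter> set (drop i bs) = {} then 0 else 1)"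
      using fin by (simp add: hook_def length_finite_permutations_of_set sum.If_cases Int_def)
  qed
  also have "\<dots> = fact ?N * real (?N - i) +
      (\<Sum>s\<in>E - T. \<Sum>bs\<in>?\<Omega>. if ?B s \<inter> set (drop i bs) = {} then 0 else 1)"
    using fin by (simp add: sum.distrib) (rule sum.swap)
  also have "(\<Sum>s\<in>E - T. \<Sum>bs\<in>?\<Omega>. if ?B s \<inter> set (drop i bs) = {} then 0 else 1 :: real) \<le>
      (\<Sum>s\<in>E - T. fact ?N * (1 - avoid_prob ?N (?N - i) (bip_degree E T s)))"
  proof (rule sum_mono)
    fix s assume s: "s \<in> E - T"
    have "(\<Sum>bs\<in>?\<Omega>. if ?B s \<inter> set (drop i bs) = {} then 0 else 1 :: real) =
        (\<Sum>bs\<in>?\<Omega>. 1 - (if ?B s \<inter> set (drop i bs) = {} then 1 else 0))"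
      by (intro sum.cong) auto
    also have "\<dots> = fact ?N - real (card (?R s))"
      using fin by (simp add: sum_subtractf sum.If_cases Int_def)
    also have "?B s \<subseteq> T"
      by (auto simp: branches_def bip_edges_def)
    then have "fact ?N - real (card (?R s)) \<le>
        fact ?N - fact ?N * avoid_prob ?N (?N - i) (card (?B s))"
      using card_permutations_suffix_avoiding[OF fin(1), of "?B s" i] assms(3) by simp
    finally show "(\<Sum>bs\<in>?\<Omega>. if ?B s \<inter> set (drop i bs) = {} then 0 else 1 :: real) \<le>
        fact ?N * (1 - avoid_prob ?N (?N - i) (bip_degree E T s))"
      by (simp add: bip_degree_chord[OF s] algebra_simps)
  qed
  finally show ?thesis
    by (simp add: mean_hook_def distrib_left sum_distrib_left)
qed

text \<open>The \<open>(card E)!\<close> of the hook length formula cancels against the number of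
  all edge orders; \<open>(card T)!\<close> is the number of branch orders, over which Jensen's
  inequality averages.\<close>

lemma prob_MST_ge:
  assumes "spanning_tree V E T" "simple_edges V E" "finite E"
  shows "prob_MST E T \<ge> fact (card T) * (\<Prod>k=1..card T. 1 / mean_hook E T k)"
proof -
  let ?\<Omega> = "permutations_of_set T" and ?B = "branches E T" and ?N = "card T" and ?S = "E - T"
  have TE: "T \<subseteq> E" using assms(1) by (simp add: spanning_tree_def)
  have fin: "finite T" "finite ?S"
    using assms(3) TE finite_subset by auto
  have cardE: "?N + card ?S = card E"
    using TE fin assms(3) by (metis card_Diff_subset card_mono le_add_diff_inverse)
  have B: "?B x = {}" if "x \<in> T" for x
    using that by (auto simp: branches_def bip_edges_def)
  have B': "?B s \<subseteq> T" for s
    by (auto simp: branches_def bip_edges_def)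
  have "(\<Union>bs\<in>?\<Omega>. heeding_lists ?B T bs ?S) \<subseteq> {es \<in> permutations_of_set E. kruskal es = T}"
  proof (intro UN_least subsetI)
    fix bs es assume "bs \<in> ?\<Omega>" "es \<in> heeding_lists ?B T bs ?S"
    then have "set es = E" "distinct es" "heeds ?B es"
      using TE by (auto simp: heeding_lists_def permutations_of_set_def)
    then show "es \<in> {es \<in> permutations_of_set E. kruskal es = T}"
      using kruskal_eq_spanning_tree[OF assms(1,2)] by (simp add: permutations_of_set_def)
  qed
  then have "card (\<Union>bs\<in>?\<Omega>. heeding_lists ?B T bs ?S) \<le>
      card {es \<in> permutations_of_set E. kruskal es = T}"
    by (intro card_mono) auto
  \<comment> \<open>The sets are disjoint because filtering an order by \<open>T\<close> recovers
    \<open>bs\<close>.\<close>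
  moreover have "card (\<Union>bs\<in>?\<Omega>. heeding_lists ?B T bs ?S) =
      (\<Sum>bs\<in>?\<Omega>. card (heeding_lists ?B T bs ?S))"
    using fin by (subst card_UN_disjoint) (auto simp: finite_heeding_lists, auto simp: heeding_lists_def)
  ultimately have "real (\<Sum>bs\<in>?\<Omega>. card (heeding_lists ?B T bs ?S)) \<le>
      real (card {es \<in> permutations_of_set E. kruskal es = T})"
    by (simp only: of_nat_le_iff)
  then have "(\<Sum>bs\<in>?\<Omega>. real (card (heeding_lists ?B T bs ?S))) \<le>
      real (card {es \<in> permutations_of_set E. kruskal es = T})"
    by (simp only: of_nat_sum)
  moreover have "real (card (heeding_lists ?B T bs ?S)) =
      fact (card E) * (\<Prod>i<?N. 1 / real (hook ?B ?S (drop i bs)))" if "bs \<in> ?\<Omega>" for bs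
  proof -
    have "length bs = ?N"
      using that by (rule length_finite_permutations_of_set)
    then show ?thesis
      using card_heeding_lists[of bs T ?S ?B] that fin B B' cardE
      by (auto simp: permutations_of_set_def prod_dividef)
  qed
  ultimately have "fact (card E) * (\<Sum>bs\<in>?\<Omega>. \<Prod>i<?N. 1 / real (hook ?B ?S (drop i bs))) \<le>
      real (card {es \<in> permutations_of_set E. kruskal es = T})"
    by (simp add: sum_distrib_left)
  moreover have "prob_MST E T = real (card {es \<in> permutations_of_set E. kruskal es = T}) / fact (card E)"
  proof -
    have "permutations_of_set E \<inter> kruskal -` {T} = {es \<in> permutations_of_set E. kruskal es = T}"
      by auto
    then show ?thesis
      using assms(3) by (simp add: prob_MST_def pmf_map measure_pmf_of_set)
  qed
  ultimately have "(\<Sum>bs\<in>?\<Omega>. \<Prod>i<?N. 1 / real (hook ?B ?S (drop i bs))) \<le> prob_MST E T"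
    by (simp add: pos_le_divide_eq mult.commute)
  moreover have "real (card ?\<Omega>) * (\<Prod>i<?N. 1 / mean_hook E T (?N - i)) \<le>
      (\<Sum>bs\<in>?\<Omega>. \<Prod>i<?N. 1 / real (hook ?B ?S (drop i bs)))"
  proof (rule sum_prod_inverse_ge)
    fix i bs assume "i \<in> {..<?N}" "bs \<in> ?\<Omega>"
    then show "real (hook ?B ?S (drop i bs)) > 0"
      using length_finite_permutations_of_set[of bs T] by (auto intro!: hook_pos)
  next
    fix i assume i: "i \<in> {..<?N}"
    then show "mean_hook E T (?N - i) > 0"
      using mean_hook_ge[of "?N - i" T E] by auto
    show "(\<Sum>bs\<in>?\<Omega>. real (hook ?B ?S (drop i bs))) \<le> real (card ?\<Omega>) * mean_hook E T (?N - i)"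
      using sum_hook_le[OF assms(3) TE] i fin by simp
  qed auto
  \<comment> \<open>The suffix \<open>drop i bs\<close> has \<open>k = ?N - i\<close>
    entries.\<close>
  moreover have "(\<Prod>i<?N. 1 / mean_hook E T (?N - i)) = (\<Prod>k=1..?N. 1 / mean_hook E T k)"
    by (rule prod.reindex_bij_witness[of _ "\<lambda>k. ?N - k" "\<lambda>i. ?N - i"]) auto
  ultimately show ?thesis
    using fin by simp
qed

subsection \<open>Asymptotics\<close>

text \<open>Writes a Riemann sum with right endpoints as an integral, to make it accessible to
  dominated convergence.\<close>

lemma has_integral_step_function:
  fixes g :: "nat \<Rightarrow> real"
  assumes "N > 0"
  shows "((\<lambda>x. g (nat \<lceil>real N * x\<rceil>)) has_integral (\<Sum>k=1..N. g k) / real N) {0..1}"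
proof -
  have "((\<lambda>x. g (nat \<lceil>real N * x\<rceil>)) has_integral (\<Sum>k=1..m. g k) / real N) {0..real m / real N}" for m
  proof (induction m)
    case 0
    show ?case by (simp add: has_integral_refl)
  next
    case (Suc m)
    let ?a = "real m / real N" and ?b = "real (Suc m) / real N"
    have ab: "?a \<le> ?b" using assms by (simp add: divide_right_mono)
    have "((\<lambda>x. g (Suc m)) has_integral g (Suc m) / real N) {?a..?b}"
      using has_integral_const_real[of "g (Suc m)" ?a ?b] ab
      by (simp add: diff_divide_distrib[symmetric])
    then have "((\<lambda>x. g (nat \<lceil>real N * x\<rceil>)) has_integral g (Suc m) / real N) {?a..?b}"
    \<comment> \<open>On the interval the ceiling is \<open>Suc m\<close> except at the left
      endpoint, which is negligible.\<close>
    proof (rule has_integral_spike_finite[of "{?a}", rotated 2])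
      fix x assume "x \<in> {?a..?b} - {?a}"
      then have "real m < real N * x" "real N * x \<le> real (Suc m)"
        using assms by (auto simp: field_simps)
      then have "\<lceil>real N * x\<rceil> = int (Suc m)"
        by (intro ceiling_unique) auto
      then show "g (nat \<lceil>real N * x\<rceil>) = g (Suc m)" by (simp only: nat_int)
    qed simp
    with Suc.IH show ?case
      using has_integral_combine[of 0 ?a ?b] ab by (fastforce simp: add_divide_distrib)
  qed
  from this[of N] show ?thesis using assms by simp
qed

text \<open>Supplies an integrable majorant of the logarithm near 0: the inequality
  \<open>ln y \<le> y - 1\<close> is applied to \<open>x powr (-1/2)\<close>, which is still
  integrable on \<open>{0..1}\<close>.\<close>

lemma abs_ln_le:
  fixes x y :: real
  assumes "0 < x" "x \<le> y" "y \<le> 2"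
  shows "\<bar>ln y\<bar> \<le> ln 2 + 2 * x powr (-1/2)"
proof -
  have "ln (x powr (-1/2)) \<le> x powr (-1/2) - 1"
    using assms by (intro ln_le_minus_one) simp
  then have "- ln x \<le> 2 * x powr (-1/2)"
    using assms by (simp add: ln_powr)
  moreover have "ln x \<le> ln y" "ln y \<le> ln 2"
    using assms by simp_all
  moreover have "ln 2 \<ge> (0::real)" "x powr (-1/2) \<ge> 0"
    by simp_all
  ultimately show ?thesis by linarith
qed

lemma nat_ceiling_mult_bounds:
  assumes "0 < x" "x < 1" "N > 0"
  shows "1 \<le> nat \<lceil>real N * x\<rceil>" "nat \<lceil>real N * x\<rceil> \<le> N" "x \<le> real (nat \<lceil>real N * x\<rceil>) / real N"
proof -
  have "0 < real N * x" using assms by simp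
  then show "1 \<le> nat \<lceil>real N * x\<rceil>" by linarith
  have "real N * x \<le> real N" using assms by simp
  then show "nat \<lceil>real N * x\<rceil> \<le> N" by linarith
  have "real N * x \<le> real (nat \<lceil>real N * x\<rceil>)" by linarith
  then show "x \<le> real (nat \<lceil>real N * x\<rceil>) / real N"
    using assms by (simp add: field_simps)
qed

text \<open>Dominated convergence for step functions. Rounding up gives
  \<open>x \<le> k / N\<close>, so the lower bound on \<open>G\<close> keeps the logarithms under a
  common majorant.\<close>

lemma mean_ln_tendsto_integral:
  fixes N :: "nat \<Rightarrow> nat" and G :: "nat \<Rightarrow> nat \<Rightarrow> real"
  assumes N: "\<And>n. N n > 0"
    and G: "\<And>n k. 1 \<le> k \<Longrightarrow> k \<le> N n \<Longrightarrow> real k / real (N n) \<le> G n k"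
           "\<And>n k. 1 \<le> k \<Longrightarrow> k \<le> N n \<Longrightarrow> G n k \<le> 2"
    and lim: "\<And>x. 0 < x \<Longrightarrow> x < 1 \<Longrightarrow> (\<lambda>n. G n (nat \<lceil>real (N n) * x\<rceil>)) \<longlonglongrightarrow> f x"
  shows "(\<lambda>n. (\<Sum>k=1..N n. ln (G n k)) / real (N n)) \<longlonglongrightarrow> integral {0..1} (\<lambda>x. ln (f x))"
proof -
  let ?F = "\<lambda>n x. ln (G n (nat \<lceil>real (N n) * x\<rceil>))"
  \<comment> \<open>The open interval leaves out the endpoints, where no convergence is
    assumed.\<close>
  have step: "(?F n has_integral (\<Sum>k=1..N n. ln (G n k)) / real (N n)) {0<..<1}" for n
    using has_integral_step_function[OF N, of "\<lambda>k. ln (G n k)" n] by (simp add: has_integral_Icc_iff_Ioo)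
  have lower: "x \<le> G n (nat \<lceil>real (N n) * x\<rceil>)" and upper: "G n (nat \<lceil>real (N n) * x\<rceil>) \<le> 2"
    if "0 < x" "x < 1" for n x
    using nat_ceiling_mult_bounds[OF that N] G order_trans by blast+
  have "(\<lambda>n. integral {0<..<1} (?F n)) \<longlonglongrightarrow> integral {0<..<1} (\<lambda>x. ln (f x))"
  proof (rule dominated_convergence(2))
    show "?F n integrable_on {0<..<1}" for n
      using step by blast
    have "(\<lambda>x::real. x powr (-1/2)) integrable_on {0..1}"
      by (rule integrable_on_powr_from_0) auto
    then have "(\<lambda>x::real. ln 2 + 2 * x powr (-1/2)) integrable_on {0..1}"
      by (intro integrable_add integrable_on_mult_right integrable_const_ivl)
    then show "(\<lambda>x::real. ln 2 + 2 * x powr (-1/2)) integrable_on {0<..<1}"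
      by (simp add: integrable_on_open_interval_real)
    show "norm (?F n x) \<le> ln 2 + 2 * x powr (-1/2)" if "x \<in> {0<..<1}" for n x
      using abs_ln_le[of x] lower[of x n] upper[of x n] that by simp
    show "(\<lambda>n. ?F n x) \<longlonglongrightarrow> ln (f x)" if "x \<in> {0<..<1}" for x
    proof (rule tendsto_ln)
      show *: "(\<lambda>n. G n (nat \<lceil>real (N n) * x\<rceil>)) \<longlonglongrightarrow> f x"
        using lim that by simp
      \<comment> \<open>The lower bound passes to the limit and keeps it away from the singularity
        of the logarithm.\<close>
      have "x \<le> f x"
        by (rule LIMSEQ_le_const[OF *]) (use lower that in auto)
      then show "f x \<noteq> 0" using that by simp
    qed
  qed
  moreover have "integral {0<..<1} (?F n) = (\<Sum>k=1..N n. ln (G n k)) / real (N n)" for n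
    using step by (rule integral_unique)
  ultimately show ?thesis
    by (simp add: integral_open_interval_real)
qed

lemma nat_ceiling_ratio_tendsto:
  fixes N :: "nat \<Rightarrow> nat"
  assumes "filterlim (\<lambda>n. real (N n)) at_top F" "0 < x"
  shows "((\<lambda>n. real (nat \<lceil>real (N n) * x\<rceil>) / real (N n)) \<longlongrightarrow> x) F"
proof (rule tendsto_sandwich)
  have pos: "eventually (\<lambda>n. real (N n) > 0) F"
    using assms(1) unfolding filterlim_at_top_dense by blast
  show "eventually (\<lambda>n. x \<le> real (nat \<lceil>real (N n) * x\<rceil>) / real (N n)) F"
    using pos
  proof eventually_elim
    case (elim n)
    have "real (N n) * x \<le> real (nat \<lceil>real (N n) * x\<rceil>)" by linarith
    then show ?case using elim by (simp add: field_simps)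
  qed
  show "eventually (\<lambda>n. real (nat \<lceil>real (N n) * x\<rceil>) / real (N n) \<le> x + 1 / real (N n)) F"
    using pos
  proof eventually_elim
    case (elim n)
    have "0 \<le> real (N n) * x" using assms(2) by simp
    then have "real (nat \<lceil>real (N n) * x\<rceil>) \<le> real (N n) * x + 1" by linarith
    then show ?case using elim by (simp add: field_simps)
  qed
  have "((\<lambda>n. 1 / real (N n)) \<longlongrightarrow> 0) F"
    by (rule real_tendsto_divide_at_top[OF tendsto_const assms(1)])
  then show "((\<lambda>n. x + 1 / real (N n)) \<longlongrightarrow> x) F"
    using tendsto_add[OF tendsto_const[of x F]] by fastforce
qed simp

text \<open>For fixed \<open>d\<close> the probability is a product of \<open>d\<close> factors,
  each of which tends to \<open>1 - x\<close>.\<close>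

lemma avoid_prob_tendsto:
  fixes N k :: "'n \<Rightarrow> nat"
  assumes N: "filterlim (\<lambda>n. real (N n)) at_top F"
    and k: "((\<lambda>n. real (k n) / real (N n)) \<longlongrightarrow> x) F" "eventually (\<lambda>n. k n \<le> N n) F"
    and "x \<le> 1"
  shows "((\<lambda>n. avoid_prob (N n) (k n) d) \<longlongrightarrow> (1 - x) ^ d) F"
proof (induction d)
  case 0
  have "eventually (\<lambda>n. 1 = avoid_prob (N n) (k n) 0) F"
    using k(2) by eventually_elim (simp add: avoid_prob_0)
  then show ?case
    by (simp add: tendsto_cong[THEN iffD1, OF _ tendsto_const])
next
  case (Suc d)
  have "((\<lambda>n. real d / real (N n)) \<longlongrightarrow> 0) F"
    by (rule real_tendsto_divide_at_top[OF tendsto_const N])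
  \<comment> \<open>\<open>max 0\<close> models the truncated subtraction of natural numbers after
    division by \<open>N n\<close>, so that limit rules apply.\<close>
  then have "((\<lambda>n. max 0 (1 - real d / real (N n) - real (k n) / real (N n)) / max 0 (1 - real d / real (N n)))
      \<longlongrightarrow> max 0 (1 - 0 - x) / max 0 (1 - 0)) F"
    using k(1) by (intro tendsto_intros) auto
  moreover have "eventually (\<lambda>n. max 0 (1 - real d / real (N n) - real (k n) / real (N n)) /
      max 0 (1 - real d / real (N n)) = real (N n - d - k n) / real (N n - d)) F"
    using filterlim_at_top_dense[THEN iffD1, OF N, rule_format, of "real d"]
  proof eventually_elim
    case (elim n)
    have "max 0 (1 - real d / real (N n) - real (k n) / real (N n)) = real (N n - d - k n) / real (N n)"
    proof -
      have *: "1 - real d / real (N n) - real (k n) / real (N n) = (real (N n) - real d - real (k n)) / real (N n)"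
        using elim by (simp add: diff_divide_distrib)
      show ?thesis
      proof (cases "d + k n \<le> N n")
        case True
        then have "real (N n - d - k n) = real (N n) - real d - real (k n)"
          by linarith
        then show ?thesis unfolding * by (metis max.absorb2 of_nat_0_le_iff divide_nonneg_nonneg)
      next
        case False
        then have "real (N n) - real d - real (k n) \<le> 0" "real (N n - d - k n) = 0"
          by linarith+
        then show ?thesis unfolding * by (simp add: divide_nonpos_nonneg max.absorb1)
      qed
    qed
    moreover have "max 0 (1 - real d / real (N n)) = real (N n - d) / real (N n)"
      using elim by (auto simp: field_simps of_nat_diff max_def)
    ultimately show ?case
      using elim by simp
  qed
  ultimately have "((\<lambda>n. real (N n - d - k n) / real (N n - d)) \<longlongrightarrow> 1 - x) F"
    using \<open>x \<le> 1\<close> by (simp add: tendsto_cong)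
  then show ?case
    unfolding avoid_prob_Suc power_Suc2 by (intro tendsto_mult Suc.IH)
qed

section \<open>Degree masses and scaled mean hooks\<close>

lemma degree_mass_nonneg: "degree_mass E T d \<ge> 0"
  by (simp add: degree_mass_def)

lemma degree_mass_le_1:
  assumes "finite E"
  shows "degree_mass E T d \<le> 1"
proof -
  have "card {e \<in> E - T. bip_degree E T e = d} \<le> card (E - T)"
    using assms by (intro card_mono) auto
  then show ?thesis
    by (simp add: degree_mass_def divide_le_eq)
qed

text \<open>Groups the chords by degree. A chord has at most \<open>card T\<close> branches, so the
  series is a finite sum; the infinite form has the same shape for every tree, which suits passage
  to the limit.\<close>

lemma sum_chords_eq_suminf:
  assumes "finite E" "T \<subseteq> E" "E - T \<noteq> {}"
    and g: "\<And>d. d > card T \<Longrightarrow> g d = 0"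
  shows "(\<Sum>s\<in>E - T. g (bip_degree E T s)) =
           real (card (E - T)) * (\<Sum>d. degree_mass E T d * g d)"
proof -
  let ?D = "\<lambda>d. {s \<in> E - T. bip_degree E T s = d}"
  have "bip_degree E T s \<le> card T" if "s \<in> E - T" for s
    using that assms(1,2) finite_subset
    by (auto simp: bip_degree_chord branches_def bip_edges_def intro!: card_mono)
  then have "(\<Sum>s\<in>E - T. g (bip_degree E T s)) = (\<Sum>d\<le>card T. \<Sum>s\<in>?D d. g (bip_degree E T s))"
    using assms(1) by (intro sum.group[symmetric]) auto
  also have "\<dots> = (\<Sum>d\<le>card T. real (card (?D d)) * g d)"
    by simp
  also have "\<dots> = real (card (E - T)) * (\<Sum>d\<le>card T. degree_mass E T d * g d)"
    using assms(1,3) by (simp add: degree_mass_def sum_distrib_left)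
  also have "(\<Sum>d\<le>card T. degree_mass E T d * g d) = (\<Sum>d. degree_mass E T d * g d)"
    using g by (intro suminf_finite[symmetric]) auto
  finally show ?thesis .
qed

text \<open>Chords of degree below \<open>3\<close> do not occur in grids; replacing their contribution by its trivial
  bound avoids having to prove this.\<close>

definition truncated_avoid_prob :: "nat \<Rightarrow> nat \<Rightarrow> nat \<Rightarrow> real" where
  "truncated_avoid_prob N k d = (if d \<ge> 3 then avoid_prob N k d else 0)"

lemma truncated_avoid_prob_bounds:
  assumes "k \<le> N" "N > 0"
  shows "0 \<le> truncated_avoid_prob N k d" "truncated_avoid_prob N k d \<le> avoid_prob N k d"
    "truncated_avoid_prob N k d \<le> 1"
  using avoid_prob_nonneg[of N k d] avoid_prob_le_1[OF assms, of d]
  by (auto simp: truncated_avoid_prob_def)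

text \<open>\<open>mean_hook\<close> per branch, with the truncated probabilities in place of the
  exact ones. Along the family it tends to the associated series.\<close>

definition scaled_hook :: "'a set set \<Rightarrow> 'a set set \<Rightarrow> nat \<Rightarrow> real" where
  "scaled_hook E T k =
     real k / real (card T) +
     (\<Sum>s\<in>E - T. 1 - truncated_avoid_prob (card T) k (bip_degree E T s)) / real (card T)"

lemma scaled_hook_ge:
  assumes "k \<le> card T" "card T > 0"
  shows "real k / real (card T) \<le> scaled_hook E T k"
  unfolding scaled_hook_def using assms truncated_avoid_prob_bounds
  by (auto intro!: sum_nonneg divide_nonneg_nonneg)

lemma scaled_hook_le:
  assumes "k \<le> card T" "card T > 0" "card (E - T) \<le> card T"
  shows "scaled_hook E T k \<le> 2"
proof -
  have "(\<Sum>s\<in>E - T. 1 - truncated_avoid_prob (card T) k (bip_degree E T s)) \<le> (\<Sum>s\<in>E - T. 1)"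
    using truncated_avoid_prob_bounds[OF assms(1,2)] by (intro sum_mono) simp
  then have "real k + (\<Sum>s\<in>E - T. 1 - truncated_avoid_prob (card T) k (bip_degree E T s)) \<le>
      2 * real (card T)"
    using assms by simp
  then show ?thesis
    using assms(2) by (simp add: scaled_hook_def add_divide_distrib[symmetric] divide_le_eq)
qed

lemma mean_hook_le_scaled:
  assumes "k \<le> card T" "card T > 0"
  shows "mean_hook E T k \<le> real (card T) * scaled_hook E T k"
proof -
  have "(\<Sum>s\<in>E - T. 1 - avoid_prob (card T) k (bip_degree E T s)) \<le>
      (\<Sum>s\<in>E - T. 1 - truncated_avoid_prob (card T) k (bip_degree E T s))"
    using truncated_avoid_prob_bounds[OF assms] by (intro sum_mono) simp
  then show ?thesis
    using assms(2) by (simp add: mean_hook_def scaled_hook_def distrib_left)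
qed

text \<open>Stirling's bound \<open>N! \<ge> (N/e)^N\<close>; the induction step is
  \<open>(1 + 1/N)^N \<le> e\<close>. The factor \<open>1/e\<close> of the theorem originates
  here.\<close>

lemma ln_fact_ge: "real N * ln (real N) - real N \<le> ln (fact N)"
proof (induction N)
  case (Suc N)
  have "real (Suc N) * ln (real (Suc N)) \<le> ln (real (Suc N)) + real N * ln (real N) + 1"
  proof (cases "N = 0")
    case False
    then have "ln (real (Suc N) / real N) \<le> real (Suc N) / real N - 1"
      by (intro ln_le_minus_one) simp
    then have "ln (real (Suc N)) - ln (real N) \<le> 1 / real N"
      using False by (simp add: ln_div field_simps)
    then have "real N * (ln (real (Suc N)) - ln (real N)) \<le> 1"
      using False by (simp add: field_simps)
    then show ?thesis by (simp add: algebra_simps)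
  qed simp
  moreover have "ln (fact (Suc N)) = ln (real (Suc N)) + ln (fact N)"
    by (simp add: ln_mult)
  ultimately show ?case using Suc.IH by simp
qed simp

text \<open>The term \<open>N ln N\<close> of Stirling's bound cancels against the factor
  \<open>N\<close> scaled out of each of the \<open>N\<close> hooks.\<close>

lemma ln_prob_MST_ge:
  assumes "spanning_tree V E T" "simple_edges V E" "finite E" "card T > 0"
  shows "ln (prob_MST E T) \<ge>
    - real (card T) * (1 + (\<Sum>k=1..card T. ln (scaled_hook E T k)) / real (card T))"
proof -
  let ?N = "card T"
  have pos: "mean_hook E T k > 0" "scaled_hook E T k > 0" if "k \<in> {1..?N}" for k
  proof -
    show "mean_hook E T k > 0"
      using mean_hook_ge[of k T E] that assms(4) by simp
    have "0 < real k / real ?N" "k \<le> ?N" using that assms(4) by simp_all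
    then show "scaled_hook E T k > 0"
      using scaled_hook_ge assms(4) less_le_trans by blast
  qed
  have "- real ?N * (1 + (\<Sum>k=1..?N. ln (scaled_hook E T k)) / real ?N) =
      real ?N * ln (real ?N) - real ?N - (\<Sum>k=1..?N. ln (real ?N) + ln (scaled_hook E T k))"
    using assms(4) by (simp add: sum.distrib algebra_simps)
  also have "\<dots> \<le> ln (fact ?N) - (\<Sum>k=1..?N. ln (mean_hook E T k))"
  proof (intro diff_mono ln_fact_ge sum_mono)
    fix k assume k: "k \<in> {1..?N}"
    then have "ln (mean_hook E T k) \<le> ln (real ?N * scaled_hook E T k)"
      using pos[OF k] mean_hook_le_scaled[of k T E] assms(4) by (subst ln_le_cancel_iff) auto
    then show "ln (mean_hook E T k) \<le> ln (real ?N) + ln (scaled_hook E T k)"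
      using pos[OF k] assms(4) by (simp add: ln_mult)
  qed
  also have "\<dots> = ln (fact ?N * (\<Prod>k=1..?N. 1 / mean_hook E T k))"
  proof -
    have "ln (\<Prod>k=1..?N. 1 / mean_hook E T k) = (\<Sum>k=1..?N. ln (1 / mean_hook E T k))"
      using pos by (intro ln_prod) (auto simp: less_le)
    also have "\<dots> = (\<Sum>k=1..?N. - ln (mean_hook E T k))"
      using pos by (intro sum.cong refl) (auto simp: ln_div)
    finally have "ln (\<Prod>k=1..?N. 1 / mean_hook E T k) = - (\<Sum>k=1..?N. ln (mean_hook E T k))"
      by (simp add: sum_negf)
    moreover have "(\<Prod>k=1..?N. 1 / mean_hook E T k) > 0"
      using pos by (intro prod_pos) auto
    then have "ln (fact ?N * (\<Prod>k=1..?N. 1 / mean_hook E T k)) =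
        ln (fact ?N) + ln (\<Prod>k=1..?N. 1 / mean_hook E T k)"
      by (intro ln_mult_pos fact_gt_zero)
    ultimately show ?thesis by linarith
  qed
  also have "\<dots> \<le> ln (prob_MST E T)"
  proof -
    have "fact ?N * (\<Prod>k=1..?N. 1 / mean_hook E T k) > 0"
      using pos by (intro mult_pos_pos prod_pos) auto
    then show ?thesis
      using prob_MST_ge[OF assms(1-3)] by simp
  qed
  finally show ?thesis .
qed

text \<open>Tannery's theorem with majorant \<open>(1 - x)^d\<close>, which is independent of
  \<open>n\<close> since \<open>k n / N n\<close> is at least \<open>x\<close>. As
  \<open>x > 0\<close>, mass escaping to large degrees does not affect the limit.\<close>

lemma truncated_series_tendsto:
  fixes N k :: "nat \<Rightarrow> nat" and p :: "nat \<Rightarrow> nat \<Rightarrow> real"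
  assumes N: "filterlim (\<lambda>n. real (N n)) at_top sequentially" "\<And>n. N n > 0"
    and k: "(\<lambda>n. real (k n) / real (N n)) \<longlonglongrightarrow> x" "\<And>n. k n \<le> N n" "\<And>n. x \<le> real (k n) / real (N n)"
    and x: "0 < x" "x < 1"
    and p: "\<And>n d. 0 \<le> p n d" "\<And>n d. p n d \<le> 1" "\<And>d. (\<lambda>n. p n d) \<longlonglongrightarrow> q d"
  shows "(\<lambda>n. \<Sum>d. p n d * truncated_avoid_prob (N n) (k n) d) \<longlonglongrightarrow>
           (\<Sum>\<^sub>\<infinity>d\<in>{3..}. q d * (1 - x) ^ d)"
proof -
  let ?a = "\<lambda>d n. p n d * truncated_avoid_prob (N n) (k n) d"
  let ?b = "\<lambda>d. q d * (if d \<ge> 3 then (1 - x) ^ d else 0)"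
  have bound: "norm (?a d n) \<le> (1 - x) ^ d" for d n
  proof -
    have "truncated_avoid_prob (N n) (k n) d \<le> (1 - real (k n) / real (N n)) ^ d"
      using truncated_avoid_prob_bounds(2)[OF k(2) N(2)] avoid_prob_le_power[OF k(2) N(2)] order_trans
      by blast
    also have "\<dots> \<le> (1 - x) ^ d"
      using k(2)[of n] k(3)[of n] N(2)[of n] by (intro power_mono) (auto simp: field_simps)
    finally have "?a d n \<le> 1 * (1 - x) ^ d"
      using p x truncated_avoid_prob_bounds(1)[OF k(2) N(2)] by (intro mult_mono) auto
    then show ?thesis
      using p truncated_avoid_prob_bounds(1)[OF k(2) N(2)] by simp
  qed
  have lim: "(\<lambda>n. ?a d n) \<longlonglongrightarrow> ?b d" for d
  proof -
    have "(\<lambda>n. truncated_avoid_prob (N n) (k n) d) \<longlonglongrightarrow> (if d \<ge> 3 then (1 - x) ^ d else 0)"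
      using avoid_prob_tendsto[OF N(1) k(1), of d] k(2) x by (simp add: truncated_avoid_prob_def)
    then show ?thesis by (intro tendsto_mult p)
  qed
  have "summable (\<lambda>d. (1 - x) ^ d)"
    using x by (intro summable_geometric) simp
  from tannerys_theorem[where a = ?a and b = ?b and M = "\<lambda>d. (1 - x) ^ d", OF lim _ this]
  have *: "summable (\<lambda>d. norm (?b d))" "(\<lambda>n. \<Sum>d. ?a d n) \<longlonglongrightarrow> suminf ?b"
    using bound by (simp_all add: case_prod_unfold)
  have "(?b has_sum suminf ?b) UNIV"
    by (rule norm_summable_imp_has_sum[OF *(1) summable_sums[OF summable_norm_cancel[OF *(1)]]])
  then have "suminf ?b = infsum ?b UNIV"
    by (simp add: infsumI)
  also have "\<dots> = (\<Sum>\<^sub>\<infinity>d\<in>{3..}. q d * (1 - x) ^ d)"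
    by (intro infsum_cong_neutral) auto
  finally show ?thesis using *(2) by simp
qed

lemma exp_ereal_mono: "a \<le> b \<Longrightarrow> exp_ereal a \<le> exp_ereal b"
  by (cases a; cases b) (auto simp: exp_ereal_def)

theorem theorem6p5:
  fixes T :: "nat \<Rightarrow> (nat \<times> nat) set set"
  assumes "\<And>n. n \<ge> 1 \<Longrightarrow> spanning_tree (grid_vertices n) (grid_edges n) (T n)"
    and "bounded_family T"
    and "convergent_family T"
    and "neighbor_independent T"
  shows "Q_minus T \<ge> ereal (1 / (exp 1 * geometric_mean (assoc_series T)))"
proof -
  define I where "I = integral {0..1} (\<lambda>x. ln (assoc_series T x))"
  \<comment> \<open>The shift by 2 starts at the 2 by 2 grid, so that branches and chords exist for
    every index.\<close>
  define E where "E n = grid_edges (n + 2)" for n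
  define U where "U n = T (n + 2)" for n
  define N where "N n = card (U n)" for n
  define b where "b n = (\<Sum>k=1..N n. ln (scaled_hook (E n) (U n) k)) / real (N n)" for n
  have tree: "spanning_tree (grid_vertices (n + 2)) (E n) (U n)" for n
    using assms(1)[of "n + 2"] by (simp add: E_def U_def)
  have sub: "U n \<subseteq> E n" for n
    using tree by (simp add: spanning_tree_def)
  have finE: "finite (E n)" for n
    by (simp add: E_def finite_grid_edges)
  have Neq: "N n = (n + 2)\<^sup>2 - 1" for n
    using card_grid_spanning_tree[OF tree[unfolded E_def]] by (simp add: N_def)
  have N: "real (N n) = (real n + 2)\<^sup>2 - 1" "N n > 0" for n
    by (simp_all add: Neq of_nat_diff power2_eq_square algebra_simps)
  have Meq: "card (E n - U n) = (n + 1)\<^sup>2" for n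
    using card_grid_chords[OF tree[unfolded E_def]] by (simp add: E_def)
  have M: "real (card (E n - U n)) = (real n + 1)\<^sup>2" "card (E n - U n) \<le> N n" for n
    by (simp_all add: Meq Neq power2_eq_square algebra_simps)
  have chords: "E n - U n \<noteq> {}" for n
    using Meq[of n] by (metis card.empty power_eq_0_iff add_is_0 one_neq_zero)
  have N_top: "filterlim (\<lambda>n. real (N n)) at_top sequentially"
    unfolding N by real_asymp
  \<comment> \<open>Asymptotically there is one chord per branch, hence the coefficient 1 in the
    limit of the scaled hooks.\<close>
  have M_lim: "(\<lambda>n. real (card (E n - U n)) / real (N n)) \<longlonglongrightarrow> 1"
    unfolding N M by real_asymp
  have mass: "(\<lambda>n. degree_mass (E n) (U n) d) \<longlonglongrightarrow> limit_mass T d" for d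
    using assms(3) unfolding convergent_family_def limit_mass_def E_def U_def
    by (intro LIMSEQ_ignore_initial_segment) (simp add: convergent_LIMSEQ_iff)
  have "b \<longlonglongrightarrow> I"
    unfolding b_def I_def
  proof (rule mean_ln_tendsto_integral)
    fix n k assume "1 \<le> k" "k \<le> N n"
    then show "real k / real (N n) \<le> scaled_hook (E n) (U n) k" "scaled_hook (E n) (U n) k \<le> 2"
      using scaled_hook_ge[of k "U n" "E n"] scaled_hook_le[of k "U n" "E n"] N(2)[of n] M(2)[of n]
      by (simp_all add: N_def)
  next
    fix x :: real assume x: "0 < x" "x < 1"
    let ?k = "\<lambda>n. nat \<lceil>real (N n) * x\<rceil>"
    let ?s = "\<lambda>n. \<Sum>d. degree_mass (E n) (U n) d * truncated_avoid_prob (N n) (?k n) d"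
    have k: "(\<lambda>n. real (?k n) / real (N n)) \<longlonglongrightarrow> x"
      by (rule nat_ceiling_ratio_tendsto[OF N_top x(1)])
    have s: "?s \<longlonglongrightarrow> (\<Sum>\<^sub>\<infinity>d\<in>{3..}. limit_mass T d * (1 - x) ^ d)"
      using nat_ceiling_mult_bounds[OF x N(2)] x N k degree_mass_le_1[OF finE] mass
      by (intro truncated_series_tendsto N_top) (auto simp: degree_mass_nonneg)
    have "(\<lambda>n. real (?k n) / real (N n) + real (card (E n - U n)) / real (N n) * (1 - ?s n)) \<longlonglongrightarrow>
        x + 1 * (1 - (\<Sum>\<^sub>\<infinity>d\<in>{3..}. limit_mass T d * (1 - x) ^ d))"
      by (intro tendsto_intros k M_lim s)
    moreover have "scaled_hook (E n) (U n) (?k n) =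
        real (?k n) / real (N n) + real (card (E n - U n)) / real (N n) * (1 - ?s n)" for n
    proof -
      have "(\<Sum>s\<in>E n - U n. truncated_avoid_prob (N n) (?k n) (bip_degree (E n) (U n) s)) =
          real (card (E n - U n)) * ?s n"
        by (intro sum_chords_eq_suminf finE sub chords)
           (simp add: truncated_avoid_prob_def avoid_prob_def N_def)
      then show ?thesis
        by (simp add: scaled_hook_def sum_subtractf right_diff_distrib diff_divide_distrib flip: N_def)
    qed
    \<comment> \<open>The summand \<open>x\<close> comes from the branches, the bracket from the
      chords.\<close>
    moreover have "assoc_series T x = x + 1 * (1 - (\<Sum>\<^sub>\<infinity>d\<in>{3..}. limit_mass T d * (1 - x) ^ d))"
      by (simp add: assoc_series_def)
    ultimately show "(\<lambda>n. scaled_hook (E n) (U n) (?k n)) \<longlonglongrightarrow> assoc_series T x"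
      by (simp only:)
  qed (use N in simp)
  \<comment> \<open>Converts from normalisation by the number of branches to that by the number of
    vertices in \<open>Q_minus\<close>.\<close>
  moreover have "(\<lambda>n. real (N n) / (real (n + 2))\<^sup>2) \<longlonglongrightarrow> 1"
    unfolding N by real_asymp
  ultimately have "(\<lambda>n. - (real (N n) / (real (n + 2))\<^sup>2) * (1 + b n)) \<longlonglongrightarrow> - 1 * (1 + I)"
    by (intro tendsto_intros)
  then have lim: "(\<lambda>n. ereal (- (real (N n) / (real (n + 2))\<^sup>2) * (1 + b n))) \<longlonglongrightarrow> ereal (- (1 + I))"
    by simp
  let ?c = "\<lambda>n. ereal (ln (prob_MST (grid_edges n) (T n)) / (real n)\<^sup>2)"
  have "ereal (- (1 + I)) = liminf (\<lambda>n. ereal (- (real (N n) / (real (n + 2))\<^sup>2) * (1 + b n)))"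
    by (rule lim_imp_Liminf[symmetric, OF _ lim]) simp
  also have "\<dots> \<le> liminf (\<lambda>n. ?c (n + 2))"
  proof (intro Liminf_mono always_eventually allI)
    fix n
    have "- real (N n) * (1 + b n) \<le> ln (prob_MST (E n) (U n))"
      using ln_prob_MST_ge[OF tree _ finE, of n] simple_edges_grid[of "n + 2"] N(2)[of n]
      by (simp add: b_def N_def E_def)
    then have "- real (N n) * (1 + b n) / (real (n + 2))\<^sup>2 \<le> ln (prob_MST (E n) (U n)) / (real (n + 2))\<^sup>2"
      by (rule divide_right_mono) simp
    then show "ereal (- (real (N n) / (real (n + 2))\<^sup>2) * (1 + b n)) \<le> ?c (n + 2)"
      by (simp add: E_def U_def)
  qed
  also have "\<dots> = liminf ?c"
    by (rule liminf_shift_k)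
  finally have "exp_ereal (ereal (- (1 + I))) \<le> Q_minus T"
    unfolding Q_minus_def by (rule exp_ereal_mono)
  moreover have "exp (- (1 + I)) = 1 / (exp 1 * geometric_mean (assoc_series T))"
    by (simp add: geometric_mean_def I_def exp_minus exp_add exp_diff field_simps)
  ultimately show ?thesis
    by (simp add: exp_ereal_def)
qed

end
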